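(* Let $f\colon[0,1]\to[0,1]$ be a two-branched interval map for which there exists $r_1\in(0,1)$ such that conditions (1)--(5) of the context hold. Then the set of points with positive lower Lyapunov exponent for $f$, $$S:=\{x\in[0,1]\colon \underline{L}(x)>0\},$$ is strong winning for Schmidt's game on $[0,1]$.
   Context: Conditions on $f$ and $r_1$ (one-sided derivatives are used where needed; at $r_1$ the one-sided derivatives are understood as the one-sided limits of $f'$): (1) $f((0,r_1))=f((r_1,1))=(0,1)$; (2) $f$ is $C^1$ on $[0,r_1)$ and $C^2$ on $(0,r_1)\cup(r_1,1]$; (3) $f(0)=f(r_1)=0$, $f'(0)=1$, and $|f'|>1$ on $(0,1]$ (including both one-sided derivatives at $r_1$; hence $\inf_{x\in[\epsilon,1]}|f'(x)|>1$ for every $\epsilon>0$); (4) $\sup_{x\in[0,1]}|f'(x)|<\infty$ and $\sup_{x\in(r_1,1]}|f''(x)|<\infty$; (5) there exist $C\ge1$ and $\gamma>0$ such that $C^{-1}\le f''(x)/x^{\gamma-1}\le C$ for all $x\in(0,r_1)$. On $(r_1,1]$ the map $f$ may be either increasing or decreasing. Lower Lyapunov exponent: for $x\in[0,1]$, $$\underline{L}(x):=\liminf_{n\to\infty}\frac1n\log|(f^n)'(x)|,$$ where $(f^n)'(x)=\prod_{k=0}^{n-1}f'(f^kx)$ and one-sided derivatives are used as necessary. Strong winning. Let $X$ be a compact nondegenerate interval, $S\subset X$, and $\alpha,\beta\in(0,1)$. In the strong $(\alpha,\beta)$-game, two players Bob and Alice alternately choose nested nondegenerate closed intervals $X\supset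 B_1\supset A_1\supset B_2\supset A_2\supset\cdots$, Bob choosing $B_1$ (of arbitrary length), then Alice $A_1$, and so on, subject to $|A_n|\ge\alpha|B_n|$ and $|B_{n+1}|\ge\beta|A_n|$ for all $n\ge 1$ ($|\cdot|$ denotes length). Alice wins if and only if $\bigcap_n B_n$ meets $S$ (when $\bigcap_n B_n=\{\omega\}$ this means $\omega\in S$). $S$ is $(\alpha,\beta)$-strong winning if Alice has a strategy that wins regardless of Bob's choices; $\alpha$-strong winning if it is $(\alpha,\beta)$-strong winning for every $\beta\in(0,1)$; strong winning if it is $\alpha$-strong winning for some $\alpha\in(0,1)$. *)

theory Defs
  imports "HOL-Analysis.Analysis"
begin

text \<open>The function \<open>f'\<close> supplies the (one-sided where necessary) derivative of \<open>f\<close>; the product is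
  \<open>(f ^^ n)' x\<close> by the chain rule.  The liminf is taken in \<^typ>\<open>ereal\<close>.\<close>

definition lower_lyapunov :: "(real \<Rightarrow> real) \<Rightarrow> (real \<Rightarrow> real) \<Rightarrow> real \<Rightarrow> ereal" where
  "lower_lyapunov f f' x =
     liminf (\<lambda>n. ereal (1 / real n * ln \<bar>\<Prod>k<n. f' ((f ^^ k) x)\<bar>))"

definition nondegenerate_closed_interval :: "real set \<Rightarrow> bool" where
  "nondegenerate_closed_interval I \<longleftrightarrow> (\<exists>a b. a < b \<and> I = {a..b})"

text \<open>Rounds are numbered from 0: Bob plays \<open>B 0\<close>, Alice \<open>A 0\<close>, Bob \<open>B 1\<close>, and so on.\<close>

definition bob_legal ::
  "real set \<Rightarrow> real \<Rightarrow> (nat \<Rightarrow> real set) \<Rightarrow> (nat \<Rightarrow> real set) \<Rightarrow> nat \<Rightarrow> bool" where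
  "bob_legal X \<beta> B A n \<longleftrightarrow> nondegenerate_closed_interval (B n) \<and>
     (case n of
        0 \<Rightarrow> B 0 \<subseteq> X
      | Suc m \<Rightarrow> B n \<subseteq> A m \<and> measure lborel (B n) \<ge> \<beta> * measure lborel (A m))"

definition alice_legal ::
  "real \<Rightarrow> (nat \<Rightarrow> real set) \<Rightarrow> (nat \<Rightarrow> real set) \<Rightarrow> nat \<Rightarrow> bool" where
  "alice_legal \<alpha> B A n \<longleftrightarrow> nondegenerate_closed_interval (A n) \<and>
     A n \<subseteq> B n \<and> measure lborel (A n) \<ge> \<alpha> * measure lborel (B n)"

text \<open>A strategy for Alice maps the finite list of Bob's moves so far to her reply; her own earlier
  moves are determined by these.  Her reply has to be legal as soon as Bob's moves have been legal
  up to that round: otherwise she could win vacuously by an illegal move that leaves Bob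
  without a legal continuation.\<close>

definition alice_moves :: "(real set list \<Rightarrow> real set) \<Rightarrow> (nat \<Rightarrow> real set) \<Rightarrow> nat \<Rightarrow> real set" where
  "alice_moves \<sigma> B n = \<sigma> (map B [0..<Suc n])"

definition winning_strategy ::
  "real set \<Rightarrow> real \<Rightarrow> real \<Rightarrow> real set \<Rightarrow> (real set list \<Rightarrow> real set) \<Rightarrow> bool" where
  "winning_strategy X \<alpha> \<beta> S \<sigma> \<longleftrightarrow>
     (\<forall>B. (\<forall>n. (\<forall>m\<le>n. bob_legal X \<beta> B (alice_moves \<sigma> B) m) \<longrightarrow>
                alice_legal \<alpha> B (alice_moves \<sigma> B) n) \<and>
          ((\<forall>n. bob_legal X \<beta> B (alice_moves \<sigma> B) n) \<longrightarrow> (\<Inter>n. B n) \<inter> S \<noteq> {}))"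

definition alpha_beta_strong_winning ::
  "real set \<Rightarrow> real \<Rightarrow> real \<Rightarrow> real set \<Rightarrow> bool" where
  "alpha_beta_strong_winning X \<alpha> \<beta> S \<longleftrightarrow> (\<exists>\<sigma>. winning_strategy X \<alpha> \<beta> S \<sigma>)"

definition alpha_strong_winning :: "real set \<Rightarrow> real \<Rightarrow> real set \<Rightarrow> bool" where
  "alpha_strong_winning X \<alpha> S \<longleftrightarrow> (\<forall>\<beta>\<in>{0<..<1}. alpha_beta_strong_winning X \<alpha> \<beta> S)"

definition strong_winning :: "real set \<Rightarrow> real set \<Rightarrow> bool" where
  "strong_winning X S \<longleftrightarrow> (\<exists>\<alpha>\<in>{0<..<1}. alpha_strong_winning X \<alpha> S)"

text \<open>\<open>branch_derivatives f r\<^sub>1 f' f''\<close>: on \<open>[0,1]\<close> the map \<open>f\<close> is \<open>C\<^sup>1\<close> on \<open>[0,r\<^sub>1)\<close> and \<open>C\<^sup>2\<close> on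
  \<open>(0,r\<^sub>1) \<union> (r\<^sub>1,1]\<close>, with derivatives \<open>f'\<close> and \<open>f''\<close> (one-sided at the endpoints \<open>0\<close> and \<open>1\<close>).
  This determines \<open>f'\<close> on \<open>[0,1] - {r\<^sub>1}\<close>.  At the branch point, where \<open>f\<close> need not be continuous,
  \<open>f' r\<^sub>1\<close> is allowed to be either one of the one-sided limits of \<open>f'\<close>.\<close>

definition branch_derivatives ::
  "(real \<Rightarrow> real) \<Rightarrow> real \<Rightarrow> (real \<Rightarrow> real) \<Rightarrow> (real \<Rightarrow> real) \<Rightarrow> bool" where
  "branch_derivatives f r\<^sub>1 f' f'' \<longleftrightarrow>
     (\<forall>x\<in>{0..1} - {r\<^sub>1}. (f has_real_derivative f' x) (at x within {0..1})) \<and>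
     continuous_on {0..<r\<^sub>1} f' \<and>
     (\<forall>x\<in>{0<..<r\<^sub>1} \<union> {r\<^sub>1<..1}. (f' has_real_derivative f'' x) (at x within {0..1})) \<and>
     continuous_on ({0<..<r\<^sub>1} \<union> {r\<^sub>1<..1}) f'' \<and>
     ((f' \<longlongrightarrow> f' r\<^sub>1) (at_left r\<^sub>1) \<or> (f' \<longlongrightarrow> f' r\<^sub>1) (at_right r\<^sub>1))"

end

theory Submission
  imports Defs
begin

text \<open>
  A point whose orbit stays above some \<open>\<epsilon> > 0\<close> has positive lower exponent, and an orbit can come
  close to \<open>0\<close> only after passing close to the branch point \<open>r\<close>.  So it suffices to stay away from
  the preimages \<open>phi w r\<close> of the branch point, where \<open>phi w\<close> runs over the compositions of the two inverse
  branches, at distance at least a fixed multiple of the size \<open>rad w\<close> of the image under \<open>phi w\<close> of a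
  neighbourhood of \<open>r\<close>.

  For distinct words one of the two preimages lies outside the cylinder of the other, whence
  \<open>\<bar>phi v r - phi w r\<bar> \<ge> min (rad v) (rad w)\<close>.  With such a separation Alice meets at most one new
  obstacle per round, and its forbidden neighbourhood is short compared with Bob's interval.

  That orbits far from the preimages do avoid \<open>0\<close> needs bounded distortion of \<open>phi w\<close> on \<open>(g r, 1)\<close>.
  Along an excursion near the neutral fixed point the derivative of \<open>g ^^ k\<close> is
  dominated by the gap \<open>f x - x\<close>, which makes the distortion a telescoping sum; between excursions the
  right branch contracts uniformly.
\<close>

section \<open>The game against separated points\<close>

text \<open>Two obstacles with \<open>\<sigma> i\<close> at least \<open>2 * (b - a)\<close> and
  radius at most \<open>(b - a) / 8\<close> that both reach \<open>{a..b}\<close> would have centres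
  closer than \<open>sep\<close> allows, so there is at most one. It is avoided by choosing in the
  half of \<open>{a..b}\<close> away from its centre; the margin \<open>(b - a) / 8\<close> keeps
  the choice off \<open>a\<close> and \<open>b\<close>.\<close>

lemma separated_points_avoid:
  fixes y \<sigma> :: "'i \<Rightarrow> real"
  assumes sep: "\<And>i j. i \<noteq> j \<Longrightarrow> min (\<sigma> i) (\<sigma> j) \<le> \<bar>y i - y j\<bar>" and "a < b"
  shows "\<exists>c\<in>{a + (b - a) / 8..b - 3 * (b - a) / 8}.
           \<forall>i. 2 * (b - a) \<le> \<sigma> i \<and> \<delta> * \<sigma> i \<le> (b - a) / 8 \<longrightarrow>
               (\<forall>x\<in>{c..c + (b - a) / 4}. \<delta> * \<sigma> i \<le> \<bar>x - y i\<bar>)"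
proof -
  define near where "near i \<longleftrightarrow> 2 * (b - a) \<le> \<sigma> i \<and> \<delta> * \<sigma> i \<le> (b - a) / 8 \<and>
    (\<exists>x\<in>{a..b}. \<bar>x - y i\<bar> < \<delta> * \<sigma> i)" for i
  have unique: "i = j" if "near i" "near j" for i j
  proof (rule ccontr)
    assume "i \<noteq> j"
    with that sep[of i j] have far: "2 * (b - a) \<le> \<bar>y i - y j\<bar>"
      by (auto simp: near_def)
    from that obtain x z where "x \<in> {a..b}" "z \<in> {a..b}"
      "\<bar>x - y i\<bar> < (b - a) / 8" "\<bar>z - y j\<bar> < (b - a) / 8"
      unfolding near_def by (meson less_le_trans)
    with far \<open>a < b\<close> show False
      by (simp add: abs_if split: if_splits)
  qed
  have "\<exists>c\<in>{a + (b - a) / 8..b - 3 * (b - a) / 8}.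
          \<forall>i. near i \<longrightarrow> (\<forall>x\<in>{c..c + (b - a) / 4}. \<delta> * \<sigma> i \<le> \<bar>x - y i\<bar>)"
  proof (cases "\<exists>i. near i")
    case True
    then obtain k where k: "near k" by blast
    \<comment> \<open>Both candidate intervals start or end \<open>(b - a) / 8\<close> away from the
      midpoint, on the side opposite to \<open>y k\<close>.\<close>
    define c where "c = (if y k \<le> (a + b) / 2 then b - 3 * (b - a) / 8 else a + (b - a) / 8)"
    have "\<delta> * \<sigma> k \<le> \<bar>x - y k\<bar>" if "x \<in> {c..c + (b - a) / 4}" for x
    proof -
      have "(b - a) / 8 \<le> \<bar>x - y k\<bar>"
        using that \<open>a < b\<close> unfolding c_def by (auto split: if_splits simp: field_simps abs_if)
      with k show ?thesis
        by (simp add: near_def)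
    qed
    moreover have "c \<in> {a + (b - a) / 8..b - 3 * (b - a) / 8}"
      using \<open>a < b\<close> by (auto simp: c_def field_simps)
    ultimately show ?thesis
      using unique k by blast
  next
    case False
    with \<open>a < b\<close> show ?thesis
      by (intro bexI[of _ "a + (b - a) / 8"]) (auto simp: field_simps)
  qed
  then obtain c where c: "c \<in> {a + (b - a) / 8..b - 3 * (b - a) / 8}"
    "\<And>i x. near i \<Longrightarrow> x \<in> {c..c + (b - a) / 4} \<Longrightarrow> \<delta> * \<sigma> i \<le> \<bar>x - y i\<bar>"
    by blast
  have "\<delta> * \<sigma> i \<le> \<bar>x - y i\<bar>"
    if "2 * (b - a) \<le> \<sigma> i" "\<delta> * \<sigma> i \<le> (b - a) / 8" "x \<in> {c..c + (b - a) / 4}" for i x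
  proof (cases "near i")
    case True
    with c that show ?thesis by blast
  next
    case False
    moreover have "x \<in> {a..b}"
      using c(1) that(3) \<open>a < b\<close> by (auto simp: field_simps)
    ultimately show ?thesis
      using that by (force simp: near_def)
  qed
  with c(1) show ?thesis
    by blast
qed

text \<open>Obstacle \<open>i\<close> is dealt with in the first round where Bob's interval has
  length at most \<open>\<sigma> i / 2\<close>; this round comes because lengths shrink by a factor
  of at least 4. One \<open>\<delta>\<close> must serve all obstacles but may depend on the play, so
  it is read off Bob's first interval.\<close>

lemma strong_winning_avoid_separated_points:
  fixes y \<sigma> :: "'i \<Rightarrow> real"
  assumes pos: "\<And>i. 0 < \<sigma> i" and le1: "\<And>i. \<sigma> i \<le> 1"
    and sep: "\<And>i j. i \<noteq> j \<Longrightarrow> min (\<sigma> i) (\<sigma> j) \<le> \<bar>y i - y j\<bar>"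
    and S: "\<And>x \<delta>. x \<in> {0<..<1} \<Longrightarrow> 0 < \<delta> \<Longrightarrow> (\<And>i. \<delta> * \<sigma> i \<le> \<bar>x - y i\<bar>) \<Longrightarrow> x \<in> S"
  shows "strong_winning {0..1} S"
proof -
  have "alpha_beta_strong_winning {0..1} (1 / 4) \<beta> S" if \<beta>: "\<beta> \<in> {0<..<1}" for \<beta>
  proof -
    define good where "good \<delta> a b c \<longleftrightarrow> c \<in> {a + (b - a) / 8..b - 3 * (b - a) / 8} \<and>
      (\<forall>i. 2 * (b - a) \<le> \<sigma> i \<and> \<delta> * \<sigma> i \<le> (b - a) / 8 \<longrightarrow>
           (\<forall>x\<in>{c..c + (b - a) / 4}. \<delta> * \<sigma> i \<le> \<bar>x - y i\<bar>))" for \<delta> a b c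
    define c where "c \<delta> a b = (SOME c. good \<delta> a b c)" for \<delta> a b
    have ex_good: "\<exists>c. good \<delta> a b c" if "a < b" for \<delta> a b
      using separated_points_avoid[OF sep that, where \<delta> = \<delta>] by (simp only: Bex_def good_def)
    have c: "good \<delta> a b (c \<delta> a b)" if "a < b" for \<delta> a b
      unfolding c_def by (rule someI_ex) (rule ex_good[OF that])
    define reply where "reply \<delta> I = {c \<delta> (Inf I) (Sup I)..c \<delta> (Inf I) (Sup I) + (Sup I - Inf I) / 4}" for \<delta> and I :: "real set"
    have reply: "nondegenerate_closed_interval (reply \<delta> I) \<and> reply \<delta> I \<subseteq> I \<and>
        reply \<delta> I \<inter> {Inf I, Sup I} = {} \<and> measure lborel (reply \<delta> I) = measure lborel I / 4 \<and>
        (\<forall>i. 2 * measure lborel I \<le> \<sigma> i \<and> \<delta> * \<sigma> i \<le> measure lborel I / 8 \<longrightarrow>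
           (\<forall>x\<in>reply \<delta> I. \<delta> * \<sigma> i \<le> \<bar>x - y i\<bar>))"
      if I: "nondegenerate_closed_interval I" for \<delta> I
    proof -
      from I obtain a b where ab: "a < b" "I = {a..b}"
        by (auto simp: nondegenerate_closed_interval_def)
      have r: "reply \<delta> I = {c \<delta> a b..c \<delta> a b + (b - a) / 4}"
        using ab by (simp add: reply_def)
      have "nondegenerate_closed_interval (reply \<delta> I)"
        unfolding r nondegenerate_closed_interval_def
        by (rule exI[of _ "c \<delta> a b"], rule exI[of _ "c \<delta> a b + (b - a) / 4"]) (use ab in simp)
      moreover have "reply \<delta> I \<subseteq> I" "reply \<delta> I \<inter> {Inf I, Sup I} = {}"
        unfolding r using c[OF ab(1), of \<delta>] ab by (auto simp: good_def field_simps)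
      ultimately show ?thesis
        using c[OF ab(1), of \<delta>] ab unfolding r by (simp add: good_def)
    qed
    \<comment> \<open>At her first move with \<open>2 * measure lborel B \<le> \<sigma> i\<close> Alice still has
      \<open>\<sigma> i < 8 / \<beta> * measure lborel B\<close> (or \<open>\<sigma> i \<le> 1\<close> in the first round), so the forbidden radius
      is at most an eighth of the length of \<open>B\<close>.\<close>
    define \<delta> where "\<delta> I = min (\<beta> / 64) (measure lborel I / 8)" for I :: "real set"
    \<comment> \<open>\<open>hd bs\<close> is Bob's opening move, so the same
      \<open>\<delta>\<close> is used in every round.\<close>
    define strat where "strat bs = reply (\<delta> (hd bs)) (last bs)" for bs
    have moves: "alice_moves strat B n = reply (\<delta> (B 0)) (B n)" for B n
    proof -
      have "hd (map B [0..<Suc n]) = B 0"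
        by (simp add: hd_map del: upt_Suc)
      then show ?thesis
        by (simp add: alice_moves_def strat_def)
    qed
    have "winning_strategy {0..1} (1 / 4) \<beta> S strat"
      unfolding winning_strategy_def
    proof (intro allI conjI impI)
      fix B n
      assume "\<forall>m\<le>n. bob_legal {0..1} \<beta> B (alice_moves strat B) m"
      then have "nondegenerate_closed_interval (B n)"
        by (auto simp: bob_legal_def)
      from reply[OF this, of "\<delta> (B 0)"] show "alice_legal (1 / 4) B (alice_moves strat B) n"
        by (simp add: alice_legal_def moves)
    next
      fix B
      assume legal: "\<forall>n. bob_legal {0..1} \<beta> B (alice_moves strat B) n"
      define A where "A n = reply (\<delta> (B 0)) (B n)" for n
      define \<rho> where "\<rho> n = measure lborel (B n)" for n
      have nd: "nondegenerate_closed_interval (B n)" for n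
        using legal by (auto simp: bob_legal_def)
      have BA: "B (Suc n) \<subseteq> A n" "\<beta> * measure lborel (A n) \<le> \<rho> (Suc n)" for n
        using legal[rule_format, of "Suc n"] by (auto simp: bob_legal_def moves A_def \<rho>_def)
      have AB: "A n \<subseteq> B n" "measure lborel (A n) = \<rho> n / 4" for n
        using reply[OF nd, of "\<delta> (B 0)" n] by (auto simp: A_def \<rho>_def)
      have \<rho>pos: "0 < \<rho> n" for n
        using nd[of n] by (auto simp: \<rho>_def nondegenerate_closed_interval_def)
      have \<rho>lower: "\<beta> / 4 * \<rho> n \<le> \<rho> (Suc n)" for n
        using BA(2)[of n] by (simp add: AB)
      have \<rho>upper: "\<rho> (Suc n) \<le> \<rho> n / 4" for n
      proof -
        have "measure lborel (B (Suc n)) \<le> measure lborel (A n)"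
          using nd[of "Suc n"] nd[of n] BA(1)[of n] reply[OF nd, of "\<delta> (B 0)" n]
          by (auto simp: nondegenerate_closed_interval_def A_def)
        then show ?thesis
          by (simp add: \<rho>_def[symmetric] AB)
      qed
      have B0: "B 0 \<subseteq> {0..1}"
        using legal[rule_format, of 0] by (simp add: bob_legal_def)
      have \<rho>pow: "\<rho> n \<le> \<rho> 0 * (1 / 4) ^ n" for n
        by (induction n) (use \<rho>upper in \<open>auto intro: order_trans\<close>)
      have dec: "decseq B"
        by (rule decseq_SucI) (use BA AB in blast)
      have "(\<Inter>n. B n) \<noteq> {}"
      proof (rule compact_nest)
        show "compact (B n)" "B n \<noteq> {}" for n
          using nd[of n] by (auto simp: nondegenerate_closed_interval_def)
        show "B n \<subseteq> B m" if "m \<le> n" for m n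
          using dec that by (auto dest: decseqD)
      qed
      then obtain x where x: "\<And>n. x \<in> B n" by blast
      have xA: "x \<in> A n" for n
        using x BA by blast
      have d0: "0 < \<delta> (B 0)"
        using \<beta> \<rho>pos[of 0] by (simp add: \<delta>_def \<rho>_def)
      have "x \<in> S"
      proof (rule S)
        from nd[of 0] obtain a b where ab: "a < b" "B 0 = {a..b}"
          by (auto simp: nondegenerate_closed_interval_def)
        \<comment> \<open>Replies avoid the ends of Bob's interval, which excludes 0 and 1 even if
          he opens with \<open>{0..1}\<close>.\<close>
        have "x \<noteq> a" "x \<noteq> b"
          using reply[OF nd, of "\<delta> (B 0)" 0] xA[of 0] ab by (auto simp: A_def)
        with x[of 0] B0 ab show "x \<in> {0<..<1}" by auto
      next
        fix i
        have "(\<lambda>n. \<rho> 0 * (1 / 4) ^ n) \<longlonglongrightarrow> 0"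
          by (intro tendsto_mult_right_zero LIMSEQ_power_zero) simp
        then have "eventually (\<lambda>n. \<rho> 0 * (1 / 4) ^ n < \<sigma> i / 2) sequentially"
          by (rule order_tendstoD(2)) (rule half_gt_zero[OF pos])
        then obtain N where "\<rho> 0 * (1 / 4) ^ N < \<sigma> i / 2"
          by (auto simp: eventually_sequentially)
        then have "\<exists>n. 2 * \<rho> n \<le> \<sigma> i"
          using \<rho>pow[of N] by (intro exI[of _ N]) simp
        define n where "n = (LEAST n. 2 * \<rho> n \<le> \<sigma> i)"
        have n: "2 * \<rho> n \<le> \<sigma> i"
          unfolding n_def by (rule LeastI_ex) fact
        have "\<delta> (B 0) * \<sigma> i \<le> \<rho> n / 8"
        proof (cases n)
          case 0
          have "\<delta> (B 0) * \<sigma> i \<le> \<delta> (B 0) * 1"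
            using d0 le1[of i] by (intro mult_left_mono) auto
          then show ?thesis
            by (simp add: \<delta>_def 0 \<rho>_def)
        next
          case (Suc m)
          then have "\<sigma> i < 2 * \<rho> m"
            using not_less_Least[of m "\<lambda>n. 2 * \<rho> n \<le> \<sigma> i"] n_def by auto
          then have "\<delta> (B 0) * \<sigma> i \<le> \<beta> / 64 * (2 * \<rho> m)"
            using d0 pos[of i] \<beta> by (intro mult_mono) (auto simp: \<delta>_def)
          also have "\<dots> \<le> \<rho> n / 8"
            using \<rho>lower[of m] by (simp add: Suc)
          finally show ?thesis .
        qed
        with n reply[OF nd, of "\<delta> (B 0)" n] xA[of n] show "\<delta> (B 0) * \<sigma> i \<le> \<bar>x - y i\<bar>"
          by (auto simp: A_def \<rho>_def)
      qed (fact d0)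
      with x show "\<Inter> (range B) \<inter> S \<noteq> {}" by blast
    qed
    then show ?thesis
      by (auto simp: alpha_beta_strong_winning_def)
  qed
  then show ?thesis
    unfolding strong_winning_def alpha_strong_winning_def
    by (intro bexI[of _ "1 / 4"]) auto
qed

section \<open>Mean value theorem and elementary real estimates\<close>

text \<open>The endpoints may come in either order because compositions of branches may reverse
  orientation.\<close>

lemma mvt_between:
  fixes F F' :: "real \<Rightarrow> real"
  assumes "\<And>x. x \<in> {l<..<u} \<Longrightarrow> (F has_real_derivative F' x) (at x)"
    and "a \<in> {l<..<u}" "b \<in> {l<..<u}"
  shows "\<exists>\<xi>\<in>{min a b..max a b}. F b - F a = F' \<xi> * (b - a)"
proof (rule linorder_cases[of a b])
  assume "a < b"
  with assms obtain z where "a < z" "z < b" "F b - F a = (b - a) * F' z"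
    using MVT2[of a b F F'] by (metis greaterThanLessThan_iff less_le_trans order_le_less_trans)
  then show ?thesis
    by (intro bexI[of _ z]) auto
next
  assume "b < a"
  with assms obtain z where "b < z" "z < a" "F a - F b = (a - b) * F' z"
    using MVT2[of b a F F'] by (metis greaterThanLessThan_iff less_le_trans order_le_less_trans)
  then show ?thesis
    by (intro bexI[of _ z]) (auto simp: algebra_simps)
qed auto

text \<open>The logarithm is 1-Lipschitz from 1 upwards, by \<open>ln q \<le> q - 1\<close> at
  \<open>q = v / u\<close>.\<close>

lemma abs_ln_diff_le:
  fixes a b :: real
  assumes "1 \<le> \<bar>a\<bar>" "1 \<le> \<bar>b\<bar>"
  shows "\<bar>ln \<bar>a\<bar> - ln \<bar>b\<bar>\<bar> \<le> \<bar>a - b\<bar>"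
proof -
  have *: "ln v - ln u \<le> v - u" if "1 \<le> u" "u \<le> v" for u v :: real
  proof -
    have "ln v - ln u = ln (v / u)"
      using that by (simp add: ln_div)
    also have "\<dots> \<le> v / u - 1"
      using that by (intro ln_le_minus_one) auto
    also have "\<dots> = (v - u) / u"
      using that by (simp add: field_simps)
    also have "\<dots> \<le> v - u"
      using that divide_left_mono[of 1 u "v - u"] by simp
    finally show ?thesis .
  qed
  have "\<bar>ln \<bar>a\<bar> - ln \<bar>b\<bar>\<bar> \<le> \<bar>\<bar>a\<bar> - \<bar>b\<bar>\<bar>"
    using *[of "\<bar>a\<bar>" "\<bar>b\<bar>"] *[of "\<bar>b\<bar>" "\<bar>a\<bar>"] assms
      ln_mono[of "\<bar>a\<bar>" "\<bar>b\<bar>"] ln_mono[of "\<bar>b\<bar>" "\<bar>a\<bar>"]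
    by (cases "\<bar>a\<bar> \<le> \<bar>b\<bar>") auto
  then show ?thesis by linarith
qed

text \<open>Comparability is assumed both ways because \<open>a\<close> will be
  \<open>\<gamma> - 1\<close>, which may have either sign.\<close>

lemma powr_comparable:
  fixes u v L a :: real
  assumes "0 < u" "0 < v" "u \<le> L * v" "v \<le> L * u"
  shows "u powr a \<le> L powr \<bar>a\<bar> * v powr a"
proof -
  have L: "0 < L"
    using assms by (smt (verit) mult_nonneg_nonpos2)
  show ?thesis
  proof (cases "0 \<le> a")
    case True
    then have "u powr a \<le> (L * v) powr a"
      using assms by (intro powr_mono2) auto
    then show ?thesis
      using True L assms by (simp add: powr_mult)
  next
    case False
    then have "(L * u) powr a \<le> v powr a"
      using assms by (intro powr_mono2') auto
    then have "L powr (- a) * (L powr a * u powr a) \<le> L powr (- a) * v powr a"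
      using L assms by (intro mult_left_mono) (auto simp: powr_mult)
    moreover have "L powr (- a) * (L powr a * u powr a) = u powr a"
      using L by (simp add: mult.assoc[symmetric] powr_add[symmetric])
    ultimately show ?thesis
      using False by simp
  qed
qed

section \<open>Inverse branches and their compositions\<close>

text \<open>\<open>g\<close> and \<open>h\<close> are the left and right inverse branches. Open
  intervals keep one-sided derivatives and the value at the branch point out of the way; the
  orientation of the right branch is left open.\<close>

locale parabolic_map =
  fixes f f' f'' g h :: "real \<Rightarrow> real" and r C \<gamma> M \<kappa> \<Lambda> :: real
  assumes r: "0 < r" "r < 1" and \<gamma>: "0 < \<gamma>"
    and g: "t \<in> {0<..<1} \<Longrightarrow> g t \<in> {0<..<r}" "t \<in> {0<..<1} \<Longrightarrow> f (g t) = t"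
    and gf: "x \<in> {0<..<r} \<Longrightarrow> f x \<in> {0<..<1}" "x \<in> {0<..<r} \<Longrightarrow> g (f x) = x"
    and h: "t \<in> {0<..<1} \<Longrightarrow> h t \<in> {r<..<1}" "t \<in> {0<..<1} \<Longrightarrow> f (h t) = t"
    and hf: "x \<in> {r<..<1} \<Longrightarrow> f x \<in> {0<..<1}" "x \<in> {r<..<1} \<Longrightarrow> h (f x) = x"
    and deriv: "x \<in> {0<..<1} \<Longrightarrow> x \<noteq> r \<Longrightarrow> (f has_real_derivative f' x) (at x)"
    and deriv2: "x \<in> {0<..<r} \<Longrightarrow> (f' has_real_derivative f'' x) (at x)"
    and f''_pos: "x \<in> {0<..<r} \<Longrightarrow> 0 < f'' x"
    and f''_le: "x \<in> {0<..<r} \<Longrightarrow> f'' x \<le> C * x powr (\<gamma> - 1)"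
    and f'_left: "x \<in> {0<..<r} \<Longrightarrow> 1 < f' x"
    and \<kappa>: "1 < \<kappa>" and f'_right: "x \<in> {r<..<1} \<Longrightarrow> \<kappa> \<le> \<bar>f' x\<bar>"
    and f'_lip: "x \<in> {r<..<1} \<Longrightarrow> y \<in> {r<..<1} \<Longrightarrow> \<bar>f' x - f' y\<bar> \<le> M * \<bar>x - y\<bar>"
    and f_gt: "x \<in> {0<..<r} \<Longrightarrow> x < f x"
    and f_le: "x \<in> {0<..<r} \<Longrightarrow> f x \<le> \<Lambda> * x"
begin

abbreviation I :: "real set" where "I \<equiv> {0<..<1}"

text \<open>A word is read from the outermost branch inwards; \<open>True\<close> stands for the left branch.\<close>

definition br :: "bool \<Rightarrow> real \<Rightarrow> real" where
  "br c = (if c then g else h)"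

primrec phi :: "bool list \<Rightarrow> real \<Rightarrow> real" where
  "phi [] t = t"
| "phi (c # w) t = br c (phi w t)"

text \<open>The derivative of \<open>phi w\<close>: each letter divides by \<open>f'\<close> at the
  point that it produces.\<close>

primrec dphi :: "bool list \<Rightarrow> real \<Rightarrow> real" where
  "dphi [] t = 1"
| "dphi (c # w) t = dphi w t / f' (br c (phi w t))"

lemma r_mem: "r \<in> I"
  using r by simp

lemma br_mem: "t \<in> I \<Longrightarrow> br c t \<in> I" and br_ne: "t \<in> I \<Longrightarrow> br c t \<noteq> r"
  and f_br: "t \<in> I \<Longrightarrow> f (br c t) = t"
  using g[of t] h[of t] r by (auto simp: br_def)

lemma br_inj: "s \<in> I \<Longrightarrow> t \<in> I \<Longrightarrow> br c s = br c t \<Longrightarrow> s = t"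
  using f_br by metis

lemma abs_f'_gt: "x \<in> I \<Longrightarrow> x \<noteq> r \<Longrightarrow> 1 < \<bar>f' x\<bar>"
  using f'_left[of x] f'_right[of x] \<kappa> by (cases "x < r") auto

lemma g_contracts: "\<bar>g s - g t\<bar> \<le> \<bar>s - t\<bar>" if st: "s \<in> I" "t \<in> I"
proof -
  have "\<exists>\<xi>\<in>{min (g t) (g s)..max (g t) (g s)}. f (g s) - f (g t) = f' \<xi> * (g s - g t)"
    using deriv g that r by (intro mvt_between[of 0 r]) auto
  then obtain \<xi> where \<xi>: "\<xi> \<in> {min (g t) (g s)..max (g t) (g s)}" "s - t = f' \<xi> * (g s - g t)"
    using g(2)[OF st(1)] g(2)[OF st(2)] by auto
  then have "1 \<le> \<bar>f' \<xi>\<bar>"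
    using f'_left[of \<xi>] g(1)[OF that(1)] g(1)[OF that(2)] by (auto simp: min_def max_def split: if_splits)
  then show ?thesis
    unfolding \<xi>(2) abs_mult using mult_right_mono[of 1 "\<bar>f' \<xi>\<bar>" "\<bar>g s - g t\<bar>"] by simp
qed

lemma h_contracts: "\<kappa> * \<bar>h s - h t\<bar> \<le> \<bar>s - t\<bar>" if st: "s \<in> I" "t \<in> I"
proof -
  have "\<exists>\<xi>\<in>{min (h t) (h s)..max (h t) (h s)}. f (h s) - f (h t) = f' \<xi> * (h s - h t)"
    using deriv h that r by (intro mvt_between[of r 1]) auto
  then obtain \<xi> where \<xi>: "\<xi> \<in> {min (h t) (h s)..max (h t) (h s)}" "s - t = f' \<xi> * (h s - h t)"
    using h(2)[OF st(1)] h(2)[OF st(2)] by auto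
  then have "\<kappa> \<le> \<bar>f' \<xi>\<bar>"
    using f'_right[of \<xi>] h(1)[OF that(1)] h(1)[OF that(2)] by (auto simp: min_def max_def split: if_splits)
  then show ?thesis
    unfolding \<xi>(2) abs_mult by (intro mult_right_mono) auto
qed

lemma br_contracts: "\<bar>br c s - br c t\<bar> \<le> \<bar>s - t\<bar>" if "s \<in> I" "t \<in> I"
proof (cases c)
  case False
  have "1 * \<bar>h s - h t\<bar> \<le> \<kappa> * \<bar>h s - h t\<bar>"
    using \<kappa> by (intro mult_right_mono) auto
  with h_contracts[OF that] False show ?thesis
    by (simp add: br_def)
next
  case True
  with g_contracts[OF that] show ?thesis
    by (simp add: br_def)
qed

text \<open>The contraction estimate supplies the continuity that the inverse function rule
  demands.\<close>

lemma br_deriv: "(br c has_real_derivative 1 / f' (br c t)) (at t)" if "t \<in> I"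
proof -
  have "continuous_on I (br c)"
    by (rule lipschitz_on_continuous_on[of 1], rule lipschitz_onI)
      (use br_contracts[of _ _ c] in \<open>auto simp: dist_real_def\<close>)
  then have "isCont (br c) t"
    using that by (simp add: continuous_on_eq_continuous_at)
  then have "(br c has_real_derivative inverse (f' (br c t))) (at t)"
    using that br_mem[OF that] br_ne[OF that] abs_f'_gt[of "br c t"] f_br
    by (intro DERIV_inverse_function[where f = f and a = 0 and b = 1] deriv) auto
  then show ?thesis
    by (simp add: inverse_eq_divide)
qed

lemma phi_mem: "t \<in> I \<Longrightarrow> phi w t \<in> I"
  by (induction w) (auto simp only: phi.simps intro: br_mem)

lemma phi_append: "phi (v @ w) t = phi v (phi w t)"
  by (induction v) auto

lemma dphi_append: "dphi (v @ w) t = dphi v (phi w t) * dphi w t"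
  by (induction v) (auto simp: phi_append)

lemma dphi_nonzero: "t \<in> I \<Longrightarrow> dphi w t \<noteq> 0"
proof (induction w)
  case (Cons c w)
  then have "1 < \<bar>f' (br c (phi w t))\<bar>"
    by (intro abs_f'_gt br_mem br_ne phi_mem)
  with Cons show ?case by auto
qed simp

lemma phi_deriv: "t \<in> I \<Longrightarrow> (phi w has_real_derivative dphi w t) (at t)"
proof (induction w)
  case Nil
  then show ?case by (simp add: has_real_derivative_iff_has_vector_derivative)
next
  case (Cons c w)
  from DERIV_chain2[OF br_deriv[OF phi_mem] Cons.IH, OF Cons.prems Cons.prems, of c]
  show ?case by simp
qed

lemma phi_inj: "s \<in> I \<Longrightarrow> t \<in> I \<Longrightarrow> phi w s = phi w t \<Longrightarrow> s = t"
  by (induction w) (auto simp del: greaterThanLessThan_iff dest: br_inj[OF phi_mem phi_mem])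

lemma phi_mvt: "s \<in> I \<Longrightarrow> t \<in> I \<Longrightarrow> \<exists>\<xi>\<in>{min s t..max s t}. phi w t - phi w s = dphi w \<xi> * (t - s)"
  by (rule mvt_between[OF phi_deriv])

lemma phi_contracts: "s \<in> I \<Longrightarrow> t \<in> I \<Longrightarrow> \<bar>phi w s - phi w t\<bar> \<le> \<bar>s - t\<bar>"
  by (induction w) (auto simp del: greaterThanLessThan_iff intro: order_trans[OF br_contracts] phi_mem)

text \<open>After a common prefix is stripped, either the first letters differ and the images lie on
  opposite sides of \<open>r\<close>, or one word is empty and \<open>r\<close> is not a value of
  any branch.\<close>

lemma phi_not_in_image:
  "v \<noteq> w \<Longrightarrow> phi v r \<notin> phi w ` I \<or> phi w r \<notin> phi v ` I"
proof (induction v w rule: list_induct2')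
  case (2 c v)
  then show ?case
    using br_ne[OF phi_mem] by (auto simp del: greaterThanLessThan_iff)
next
  case (3 c v)
  then show ?case
    using br_ne[OF phi_mem] by (auto simp del: greaterThanLessThan_iff)
next
  case (4 c v d w)
  show ?case
  proof (cases "c = d")
    case True
    have "phi (c # v) r \<notin> phi (c # w) ` I" if "phi v r \<notin> phi w ` I" for v w
      using that br_inj[OF phi_mem phi_mem, OF r_mem] by (fastforce simp del: greaterThanLessThan_iff)
    with 4 True show ?thesis by blast
  next
    case False
    have "br c s \<noteq> br d t" if "s \<in> I" "t \<in> I" for s t
      using False g(1)[OF that(1)] g(1)[OF that(2)] h(1)[OF that(1)] h(1)[OF that(2)]
      by (auto simp: br_def split: if_splits)
    with phi_mem r_mem show ?thesis
      by (auto simp del: greaterThanLessThan_iff)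
  qed
qed simp

subsection \<open>Bounded distortion\<close>

definition gap :: "real \<Rightarrow> real" where
  "gap x = f x - x"

text \<open>Successive left preimages of \<open>r\<close>, the endpoints of fundamental domains of
  the left branch.\<close>

definition cut :: "nat \<Rightarrow> real" where
  "cut k = (g ^^ k) r"

lemma f'_mono: "f' x \<le> f' y" if xy: "x \<in> {0<..<r}" "y \<in> {0<..<r}" "x \<le> y"
proof -
  obtain \<xi> where "\<xi> \<in> {min x y..max x y}" "f' y - f' x = f'' \<xi> * (y - x)"
    using mvt_between[of 0 r f' f'' x y] deriv2 xy by blast
  moreover from this have "0 \<le> f'' \<xi> * (y - x)"
    using f''_pos[of \<xi>] xy by (intro mult_nonneg_nonneg) auto
  ultimately show ?thesis by simp
qed

lemma gap_mono: "gap x \<le> gap y" if xy: "x \<in> {0<..<r}" "y \<in> {0<..<r}" "x \<le> y"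
proof -
  have "(gap has_real_derivative f' z - 1) (at z)" if "z \<in> {0<..<r}" for z
    unfolding gap_def using deriv[of z] that r by (auto intro!: derivative_eq_intros)
  then obtain \<xi> where "\<xi> \<in> {min x y..max x y}" "gap y - gap x = (f' \<xi> - 1) * (y - x)"
    using mvt_between[of 0 r gap "\<lambda>z. f' z - 1" x y] xy by blast
  moreover from this have "0 \<le> (f' \<xi> - 1) * (y - x)"
    using f'_left[of \<xi>] xy by (intro mult_nonneg_nonneg) auto
  ultimately show ?thesis by simp
qed

lemma gap_pos: "x \<in> {0<..<r} \<Longrightarrow> 0 < gap x"
  using f_gt by (simp add: gap_def)

lemma gap_g: "t \<in> I \<Longrightarrow> gap (g t) = t - g t"
  using g(2) by (simp add: gap_def)

lemma g_less: "t \<in> I \<Longrightarrow> g t < t"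
  using gap_pos[OF g(1)] gap_g by fastforce

text \<open>The mean value theorem on \<open>{g x..x}\<close> gives
  \<open>f x - x = f' \<xi> * (x - g x)\<close>, and \<open>f'\<close> increases on the left
  branch.\<close>

lemma gap_step: "gap x \<le> f' x * gap (g x)" if x: "x \<in> {0<..<r}"
proof -
  have xI: "x \<in> I" using x r by auto
  have gx: "g x \<in> {0<..<r}" "g x < x"
    using g(1)[OF xI] g_less[OF xI] .
  have "\<exists>\<xi>\<in>{min (g x) x..max (g x) x}. f x - f (g x) = f' \<xi> * (x - g x)"
    by (rule mvt_between[of 0 r]) (use deriv gx x r in auto)
  then obtain \<xi> where \<xi>: "\<xi> \<in> {g x..x}" "f x - x = f' \<xi> * (x - g x)"
    using gx g(2)[OF xI] by auto
  have "f' \<xi> \<le> f' x"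
    using \<xi> x gx by (intro f'_mono) auto
  then show ?thesis
    unfolding gap_g[OF xI] using gx \<xi>(2) by (simp add: gap_def mult_right_mono)
qed

lemma g_mono: "g s \<le> g t" if st: "s \<in> I" "t \<in> I" "s \<le> t"
proof (rule ccontr)
  assume "\<not> g s \<le> g t"
  moreover obtain \<xi> where "\<xi> \<in> {min (g t) (g s)..max (g t) (g s)}" "f (g s) - f (g t) = f' \<xi> * (g s - g t)"
    using mvt_between[of 0 r f f' "g t" "g s"] deriv g(1)[OF st(1)] g(1)[OF st(2)] r by auto
  ultimately have "0 < s - t"
    using f'_left[of \<xi>] g(1)[OF st(1)] g(1)[OF st(2)] g(2)[OF st(1)] g(2)[OF st(2)] by auto
  with st show False by simp
qed

section \<open>Iterates of the left inverse branch\<close>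

lemma phi_replicate: "phi (replicate m True) t = (g ^^ m) t"
  by (induction m) (auto simp: br_def)

lemma g_pow_mem: "t \<in> I \<Longrightarrow> (g ^^ m) t \<in> I"
  using phi_mem[of t "replicate m True"] by (simp add: phi_replicate)

lemma g_pow_mem_left: "t \<in> I \<Longrightarrow> (g ^^ Suc m) t \<in> {0<..<r}"
  using g(1)[OF g_pow_mem] by simp

lemma g_pow_mono: "s \<in> I \<Longrightarrow> t \<in> I \<Longrightarrow> s \<le> t \<Longrightarrow> (g ^^ m) s \<le> (g ^^ m) t"
  by (induction m) (simp_all add: g_mono g_pow_mem del: greaterThanLessThan_iff)

lemma cut_mem: "cut k \<in> I" and cut_Suc_mem: "cut (Suc k) \<in> {0<..<r}" and cut_Suc: "cut (Suc k) = g (cut k)"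
  using g_pow_mem[OF r_mem] g_pow_mem_left[OF r_mem] by (simp_all add: cut_def del: greaterThanLessThan_iff)

lemma cut_less: "cut (Suc k) < cut k"
  using g_less[OF cut_mem] by (simp add: cut_Suc)

lemma \<Lambda>_pos: "0 < \<Lambda>"
proof -
  have "0 < \<Lambda> * cut 1"
    using f_le[of "cut 1"] f_gt[of "cut 1"] cut_Suc_mem[of 0] by auto
  then show ?thesis
    using cut_mem[of 1] by (auto simp: zero_less_mult_iff)
qed

lemma cut_le: "cut k \<le> \<Lambda> * cut (Suc k)"
  using f_le[OF cut_Suc_mem] g(2)[OF cut_mem] by (simp add: cut_Suc)

text \<open>Monotone iterates are applied to \<open>g r < t\<close> for the lower bound and to
  \<open>g t \<le> r\<close> for the upper one.\<close>

lemma g_pow_between: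
  assumes t: "t \<in> {g r<..<1}"
  shows "(g ^^ Suc m) t \<in> {cut (Suc (Suc m))..cut m}"
proof -
  have tI: "t \<in> I" and grI: "g r \<in> I"
    using t g(1)[OF r_mem] r by auto
  have "cut (Suc (Suc m)) = (g ^^ Suc m) (g r)"
    by (simp add: cut_def funpow_swap1)
  moreover have "\<dots> \<le> (g ^^ Suc m) t"
    by (rule g_pow_mono[OF grI tI]) (use t in simp)
  moreover have "(g ^^ Suc m) t = (g ^^ m) (g t)"
    by (simp add: funpow_swap1)
  moreover have "g t \<in> I" "g t \<le> r"
    using g(1)[OF tI] r by auto
  then have "(g ^^ m) (g t) \<le> cut m"
    unfolding cut_def by (rule g_pow_mono[OF _ r_mem])
  ultimately show ?thesis by simp
qed

text \<open>The gap \<open>f x - x\<close> transforms almost like a vector field invariant under \<open>f\<close>, so it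
  controls the derivatives of the iterates of \<open>g\<close>.\<close>

lemma dphi_replicate:
  assumes t: "t \<in> I"
  shows "0 < dphi (replicate m True) t"
    and "dphi (replicate m True) t * gap (g t) \<le> gap ((g ^^ Suc m) t)"
proof -
  have "0 < dphi (replicate m True) t \<and>
    dphi (replicate m True) t * gap (g t) \<le> gap ((g ^^ Suc m) t)"
  proof (induction m)
    case (Suc m)
    define x where "x = (g ^^ Suc m) t"
    have x: "x \<in> {0<..<r}"
      unfolding x_def by (rule g_pow_mem_left[OF t])
    have d: "dphi (replicate (Suc m) True) t = dphi (replicate m True) t / f' x"
      by (simp add: phi_replicate br_def x_def)
    have "dphi (replicate m True) t * gap (g t) \<le> f' x * gap (g x)"
      using Suc gap_step[OF x] by (auto simp: x_def[symmetric] simp del: funpow.simps)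
    moreover have "g x = (g ^^ Suc (Suc m)) t"
      by (simp add: x_def)
    ultimately show ?case
      using f'_left[OF x] Suc unfolding d by (auto simp: divide_simps mult.commute simp del: funpow.simps)
  qed simp
  then show "0 < dphi (replicate m True) t"
    and "dphi (replicate m True) t * gap (g t) \<le> gap ((g ^^ Suc m) t)" by blast+
qed

text \<open>Collects the losses of one left step: \<open>C\<close> bounds \<open>f''\<close>,
  \<open>\<Lambda>\<^sup>2\<close> compares points of two adjacent fundamental domains,
  \<open>\<gamma>\<close> comes from differentiating \<open>x powr \<gamma>\<close>, and
  \<open>gap (g (g r))\<close> is the least gap at \<open>g t\<close> for \<open>t\<close> above
  \<open>g r\<close>.\<close>

definition KL :: real where
  "KL = C * (\<Lambda>\<^sup>2) powr \<bar>\<gamma> - 1\<bar> / (\<gamma> * gap (g (g r)))"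

lemma C_pos: "0 < C"
proof -
  have "r / 2 \<in> {0<..<r}" using r by simp
  from f''_pos[OF this] f''_le[OF this] have "0 < C * (r / 2) powr (\<gamma> - 1)"
    by linarith
  then show ?thesis
    by (simp add: zero_less_mult_iff)
qed

lemma gr_mem: "g r \<in> I"
  using g(1)[OF r_mem] r by auto

lemma KL_pos: "0 < KL"
  unfolding KL_def using C_pos \<gamma> gap_pos[OF g(1)[OF gr_mem]] \<Lambda>_pos by simp

text \<open>The difference is about \<open>f''\<close> times the length of a fundamental domain
  times the distance of \<open>s\<close> and \<open>t\<close>. As \<open>f''\<close> is of order at
  most \<open>x powr (\<gamma> - 1)\<close>, the first product is bounded by an increment of
  \<open>x powr \<gamma>\<close>, which telescopes in \<open>m\<close>.\<close>

lemma distortion_step: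
  assumes s: "s \<in> {g r<..<1}" and t: "t \<in> {g r<..<1}"
  shows "\<bar>f' ((g ^^ Suc m) s) - f' ((g ^^ Suc m) t)\<bar> \<le>
    KL * (cut m powr \<gamma> - cut (Suc m) powr \<gamma>) * \<bar>s - t\<bar>"
proof -
  have I: "s \<in> I" "t \<in> I"
    using s t gr_mem by auto
  define u v where "u = (g ^^ Suc m) s" and "v = (g ^^ Suc m) t"
  have uv: "u \<in> {0<..<r}" "v \<in> {0<..<r}" "u \<in> {cut (Suc (Suc m))..cut m}" "v \<in> {cut (Suc (Suc m))..cut m}"
    unfolding u_def v_def using g_pow_mem_left I s t g_pow_between by blast+
  obtain \<xi> where \<xi>: "\<xi> \<in> {min v u..max v u}" "f' u - f' v = f'' \<xi> * (u - v)"
    using mvt_between[of 0 r f' f'' v u] deriv2 uv by blast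
  have \<xi>': "\<xi> \<in> {0<..<r}" "\<xi> \<in> {cut (Suc (Suc m))..cut m}"
    using \<xi>(1) uv by (auto simp: min_def max_def split: if_splits)
  obtain \<tau> where \<tau>: "\<tau> \<in> {min t s..max t s}" "u - v = dphi (replicate (Suc m) True) \<tau> * (s - t)"
    using phi_mvt[OF I(2) I(1), of "replicate (Suc m) True"] unfolding phi_replicate u_def v_def by blast
  have \<tau>': "\<tau> \<in> {g r<..<1}" "\<tau> \<in> I"
    using \<tau>(1) s t gr_mem by (auto simp: min_def max_def split: if_splits)
  have "((\<lambda>x. x powr \<gamma>) has_real_derivative \<gamma> * x powr (\<gamma> - 1)) (at x)" if "x \<in> {0<..<1}" for x
    using that by (intro has_real_derivative_powr) auto
  \<comment> \<open>Turns the increment of \<open>x powr \<gamma>\<close> over the fundamental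
    domain into a value of \<open>x powr (\<gamma> - 1)\<close> times its length.\<close>
  then obtain \<zeta> where \<zeta>: "\<zeta> \<in> {min (cut (Suc m)) (cut m)..max (cut (Suc m)) (cut m)}"
    "cut m powr \<gamma> - cut (Suc m) powr \<gamma> = \<gamma> * \<zeta> powr (\<gamma> - 1) * (cut m - cut (Suc m))"
    using mvt_between[of 0 1 "\<lambda>x. x powr \<gamma>" "\<lambda>x. \<gamma> * x powr (\<gamma> - 1)" "cut (Suc m)" "cut m"] cut_mem by blast
  have E0: "0 < cut k" for k
    using cut_mem[of k] by simp
  have L2: "cut m \<le> \<Lambda>\<^sup>2 * cut (Suc (Suc m))"
  proof -
    have "cut m \<le> \<Lambda> * cut (Suc m)" by (rule cut_le)
    also have "\<dots> \<le> \<Lambda> * (\<Lambda> * cut (Suc (Suc m)))"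
      using \<Lambda>_pos by (intro mult_left_mono cut_le) auto
    finally show ?thesis by (simp add: power2_eq_square)
  qed
  have cmp: "a \<le> \<Lambda>\<^sup>2 * b" if "a \<in> {cut (Suc (Suc m))..cut m}" "b \<in> {cut (Suc (Suc m))..cut m}" for a b
  proof -
    have "\<Lambda>\<^sup>2 * cut (Suc (Suc m)) \<le> \<Lambda>\<^sup>2 * b"
      using that by (intro mult_left_mono) auto
    with L2 that show ?thesis by simp
  qed
  have \<zeta>': "\<zeta> \<in> {cut (Suc (Suc m))..cut m}"
    using \<zeta>(1) cut_less[of m] cut_less[of "Suc m"] by auto
  have "\<xi> powr (\<gamma> - 1) \<le> (\<Lambda>\<^sup>2) powr \<bar>\<gamma> - 1\<bar> * \<zeta> powr (\<gamma> - 1)"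
    using E0[of "Suc (Suc m)"] \<xi>' \<zeta>' by (intro powr_comparable cmp) auto
  then have f''1: "f'' \<xi> \<le> C * ((\<Lambda>\<^sup>2) powr \<bar>\<gamma> - 1\<bar> * \<zeta> powr (\<gamma> - 1))"
    using f''_le[OF \<xi>'(1)] C_pos by (meson mult_left_mono order_less_imp_le order_trans)
  \<comment> \<open>Since \<open>\<tau>\<close> lies above \<open>g r\<close>, its gap after one
    left step has a lower bound independent of \<open>m\<close>.\<close>
  have gaps: "0 < gap (g (g r))" "gap (g (g r)) \<le> gap (g \<tau>)"
    using \<tau>' g_mono[OF gr_mem \<tau>'(2)] g(1)[OF gr_mem] g(1)[OF \<tau>'(2)] by (auto intro: gap_mono gap_pos)
  have d0: "0 < dphi (replicate (Suc m) True) \<tau>"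
    by (rule dphi_replicate(1)[OF \<tau>'(2)])
  have "dphi (replicate (Suc m) True) \<tau> * gap (g (g r)) \<le> dphi (replicate (Suc m) True) \<tau> * gap (g \<tau>)"
    using d0 gaps by (intro mult_left_mono) auto
  also have "\<dots> \<le> gap ((g ^^ Suc (Suc m)) \<tau>)"
    by (rule dphi_replicate(2)[OF \<tau>'(2)])
  \<comment> \<open>One further application of \<open>g\<close> puts the point below
    \<open>cut (Suc m)\<close>, whose gap is exactly the length of the fundamental domain.\<close>
  also have "\<dots> \<le> gap (cut (Suc m))"
    using g_pow_between[OF \<tau>'(1), of "Suc m"] g_pow_mem_left[OF \<tau>'(2), of "Suc m"] cut_Suc_mem
    by (intro gap_mono) auto
  also have "\<dots> = cut m - cut (Suc m)"
    using gap_g[OF cut_mem] by (simp add: cut_Suc)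
  finally have d1: "dphi (replicate (Suc m) True) \<tau> \<le> (cut m - cut (Suc m)) / gap (g (g r))"
    using gaps by (simp add: pos_le_divide_eq)
  have "\<bar>f' u - f' v\<bar> = f'' \<xi> * dphi (replicate (Suc m) True) \<tau> * \<bar>s - t\<bar>"
    using \<xi>(2) \<tau>(2) d0 f''_pos[OF \<xi>'(1)] by (simp add: abs_mult del: replicate.simps)
  also have "\<dots> \<le> C * ((\<Lambda>\<^sup>2) powr \<bar>\<gamma> - 1\<bar> * \<zeta> powr (\<gamma> - 1)) * ((cut m - cut (Suc m)) / gap (g (g r))) * \<bar>s - t\<bar>"
    using f''1 d1 d0 C_pos by (intro mult_right_mono mult_mono) auto
  also have "\<dots> = KL * (cut m powr \<gamma> - cut (Suc m) powr \<gamma>) * \<bar>s - t\<bar>"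
    unfolding \<zeta>(2) KL_def using \<gamma> gaps by (simp add: field_simps)
  finally show ?thesis
    unfolding u_def v_def .
qed

section \<open>Logarithmic distortion of arbitrary words\<close>

abbreviation dist_log :: "bool list \<Rightarrow> real \<Rightarrow> real \<Rightarrow> real" where
  "dist_log w s t \<equiv> \<bar>ln \<bar>dphi w s\<bar> - ln \<bar>dphi w t\<bar>\<bar>"

lemma ln_dphi_append:
  assumes "t \<in> I"
  shows "ln \<bar>dphi (v @ w) t\<bar> = ln \<bar>dphi v (phi w t)\<bar> + ln \<bar>dphi w t\<bar>"
  using dphi_nonzero[OF assms] dphi_nonzero[OF phi_mem[OF assms]]
  by (simp add: dphi_append abs_mult ln_mult)

lemma dist_log_append_le:
  assumes "s \<in> I" "t \<in> I"
  shows "dist_log (v @ w) s t \<le> dist_log v (phi w s) (phi w t) + dist_log w s t"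
  unfolding ln_dphi_append[OF assms(1)] ln_dphi_append[OF assms(2)] by linarith

lemma dist_log_single:
  assumes "s \<in> I" "t \<in> I"
  shows "dist_log [c] s t \<le> \<bar>f' (br c s) - f' (br c t)\<bar>"
proof -
  have "ln \<bar>dphi [c] u\<bar> = - ln \<bar>f' (br c u)\<bar>" if "u \<in> I" for u
    using abs_f'_gt[OF br_mem[OF that] br_ne[OF that], of c] by (simp add: ln_div)
  with assms have "dist_log [c] s t = \<bar>ln \<bar>f' (br c s)\<bar> - ln \<bar>f' (br c t)\<bar>\<bar>"
    by (simp del: dphi.simps greaterThanLessThan_iff)
  also have "\<dots> \<le> \<bar>f' (br c s) - f' (br c t)\<bar>"
    by (intro abs_ln_diff_le less_imp_le[OF abs_f'_gt] br_mem br_ne assms)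
  finally show ?thesis .
qed

text \<open>Summing the one-step bounds telescopes to at most
  \<open>cut 0 powr \<gamma> \<le> 1\<close>, whatever the length of the excursion.\<close>

lemma distortion_left:
  assumes s: "s \<in> {g r<..<1}" and t: "t \<in> {g r<..<1}"
  shows "dist_log (replicate m True) s t \<le> KL * \<bar>s - t\<bar>"
proof -
  have I: "s \<in> I" "t \<in> I"
    using s t gr_mem by auto
  have "dist_log (replicate m True) s t \<le> KL * (cut 0 powr \<gamma> - cut m powr \<gamma>) * \<bar>s - t\<bar>"
  proof (induction m)
    case (Suc m)
    have "dist_log ([True] @ replicate m True) s t \<le>
        dist_log [True] ((g ^^ m) s) ((g ^^ m) t) + dist_log (replicate m True) s t"
      using dist_log_append_le[OF I, of "[True]" "replicate m True"] by (simp add: phi_replicate)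
    also have "dist_log [True] ((g ^^ m) s) ((g ^^ m) t) \<le> \<bar>f' ((g ^^ Suc m) s) - f' ((g ^^ Suc m) t)\<bar>"
      using dist_log_single[OF g_pow_mem[OF I(1)] g_pow_mem[OF I(2)], of True m m] by (simp add: br_def)
    also have "\<dots> \<le> KL * (cut m powr \<gamma> - cut (Suc m) powr \<gamma>) * \<bar>s - t\<bar>"
      by (rule distortion_step[OF s t])
    finally show ?case
      using Suc by (simp add: algebra_simps)
  qed simp
  also have "\<dots> \<le> KL * 1 * \<bar>s - t\<bar>"
  proof (intro mult_right_mono mult_left_mono)
    have "cut 0 powr \<gamma> \<le> 1 powr \<gamma>"
      using \<gamma> cut_mem[of 0] by (intro powr_mono2) auto
    moreover have "0 \<le> cut m powr \<gamma>" by simp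
    ultimately show "cut 0 powr \<gamma> - cut m powr \<gamma> \<le> 1"
      unfolding powr_one_eq_one by linarith
  qed (use KL_pos in auto)
  finally show ?thesis by simp
qed

lemma M_nonneg: "0 \<le> M"
proof -
  define a b where "a = r + (1 - r) / 3" and "b = r + 2 * (1 - r) / 3"
  have ab: "a \<in> {r<..<1}" "b \<in> {r<..<1}" "a < b"
    using r by (auto simp: a_def b_def field_simps)
  from f'_lip[OF ab(1,2)] have "0 \<le> M * \<bar>a - b\<bar>" by linarith
  with ab show ?thesis by (simp add: zero_le_mult_iff)
qed

text \<open>The sum of the geometric series with first term \<open>KL + M\<close> and ratio
  \<open>1 / \<kappa>\<close>: a left excursion followed by a right letter costs
  \<open>KL + M\<close> and shrinks distances by \<open>\<kappa>\<close>.\<close>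

definition D :: real where
  "D = (KL + M) * \<kappa> / (\<kappa> - 1)"

lemma D: "KL + M + D / \<kappa> = D" "0 \<le> D"
  using KL_pos M_nonneg \<kappa> by (auto simp: D_def field_simps)

text \<open>Letters are peeled off from the innermost end. A left letter joins the block of length
  \<open>m\<close>, which is why \<open>m\<close> is generalised; a right letter closes the block
  and restarts with an empty one.\<close>

lemma distortion_append:
  assumes "s \<in> {g r<..<1}" "t \<in> {g r<..<1}"
  shows "dist_log (v @ replicate m True) s t \<le> D * \<bar>s - t\<bar>"
  using assms
proof (induction v arbitrary: m s t rule: rev_induct)
  case Nil
  have "KL \<le> D"
    using D M_nonneg \<kappa> divide_nonneg_pos[of D \<kappa>] by linarith
  then have "KL * \<bar>s - t\<bar> \<le> D * \<bar>s - t\<bar>"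
    by (rule mult_right_mono) simp
  with distortion_left[OF Nil, of m] show ?case by simp
next
  case (snoc c v)
  show ?case
  proof (cases c)
    case True
    with snoc.IH[OF snoc.prems, of "Suc m"] show ?thesis by simp
  next
    case False
    have I: "s \<in> I" "t \<in> I"
      using snoc.prems gr_mem by auto
    define u where "u = (g ^^ m) s"
    define w where "w = (g ^^ m) t"
    have uw: "u \<in> I" "w \<in> I"
      using I g_pow_mem by (auto simp only: u_def w_def)
    have uw_le: "\<bar>u - w\<bar> \<le> \<bar>s - t\<bar>"
      using phi_contracts[OF I, of "replicate m True"] by (simp add: phi_replicate u_def w_def)
    \<comment> \<open>The right branch lands above \<open>r\<close>, hence again in the range where
      the induction hypothesis applies.\<close>
    have h': "h u \<in> {g r<..<1}" "h w \<in> {g r<..<1}"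
      using h(1)[OF uw(1)] h(1)[OF uw(2)] g_less[OF r_mem] by auto
    have h_le: "\<bar>h u - h w\<bar> \<le> \<bar>s - t\<bar> / \<kappa>"
      using h_contracts[OF uw] uw_le \<kappa> by (simp add: field_simps)
    have h_le1: "\<bar>h u - h w\<bar> \<le> \<bar>s - t\<bar>"
      using br_contracts[OF uw, of False] uw_le by (simp add: br_def)
    have "dist_log ((v @ [False]) @ replicate m True) s t \<le>
        dist_log (v @ [False]) u w + dist_log (replicate m True) s t"
      using dist_log_append_le[OF I, of "v @ [False]" "replicate m True"]
      unfolding phi_replicate u_def w_def .
    also have "dist_log (v @ [False]) u w \<le> dist_log v (h u) (h w) + dist_log [False] u w"
      using dist_log_append_le[OF uw, of v "[False]"] by (simp add: br_def)
    also have "dist_log v (h u) (h w) \<le> D * \<bar>h u - h w\<bar>"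
      using snoc.IH[OF h', of 0] by simp
    also have "\<dots> \<le> D * (\<bar>s - t\<bar> / \<kappa>)"
      using h_le D(2) by (intro mult_left_mono)
    also have "dist_log [False] u w \<le> \<bar>f' (h u) - f' (h w)\<bar>"
      using dist_log_single[OF uw, of False] by (simp add: br_def)
    also have "\<dots> \<le> M * \<bar>h u - h w\<bar>"
      by (rule f'_lip[OF h(1)[OF uw(1)] h(1)[OF uw(2)]])
    also have "\<dots> \<le> M * \<bar>s - t\<bar>"
      using h_le1 M_nonneg by (rule mult_left_mono)
    also have "dist_log (replicate m True) s t \<le> KL * \<bar>s - t\<bar>"
      by (rule distortion_left[OF snoc.prems])
    finally have "dist_log ((v @ [c]) @ replicate m True) s t \<le> (KL + M + D / \<kappa>) * \<bar>s - t\<bar>"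
      using False by (simp add: algebra_simps)
    then show ?thesis
      unfolding D(1) .
  qed
qed

lemma bounded_distortion:
  assumes "s \<in> {g r<..<1}" "t \<in> {g r<..<1}"
  shows "\<bar>dphi w s\<bar> \<le> exp D * \<bar>dphi w t\<bar>"
proof -
  have I: "s \<in> I" "t \<in> I"
    using assms gr_mem by auto
  have "D * \<bar>s - t\<bar> \<le> D * 1"
    using I D(2) by (intro mult_left_mono) (auto simp: abs_if)
  then have "ln \<bar>dphi w s\<bar> \<le> D + ln \<bar>dphi w t\<bar>"
    using distortion_append[OF assms, of w 0] by auto
  then have "exp (ln \<bar>dphi w s\<bar>) \<le> exp (D + ln \<bar>dphi w t\<bar>)"
    by simp
  then show ?thesis
    using dphi_nonzero I by (simp add: exp_add)
qed

subsection \<open>Orbits that avoid the neutral fixed point\<close>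

text \<open>Reference points on the two sides of \<open>r\<close>, inside the interval
  \<open>{g r<..<1}\<close> of bounded distortion.\<close>

definition q0 :: real where "q0 = (g r + r) / 2"
definition q1 :: real where "q1 = (r + 1) / 2"

text \<open>As \<open>phi w\<close> is injective and continuous, this is the inradius at
  \<open>phi w r\<close> of the image of \<open>{q0..q1}\<close>.\<close>

definition rad where
  "rad w = min \<bar>phi w r - phi w q0\<bar> \<bar>phi w q1 - phi w r\<bar>"

lemma q_order: "g r < q0" "q0 < r" "r < q1" "q1 < 1" "q0 \<in> I" "q1 \<in> I"
  using g_less[OF r_mem] r gr_mem by (auto simp: q0_def q1_def)

lemma rad_pos: "0 < rad w"
  using phi_inj[OF r_mem q_order(5), of w] phi_inj[OF r_mem q_order(6), of w] q_order
  by (auto simp: rad_def)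

lemma rad_le_1: "rad w \<le> 1"
  using phi_mem[OF r_mem, of w] phi_mem[OF q_order(5), of w] by (auto simp: rad_def)

lemma continuous_on_phi: "continuous_on I (phi w)"
  using phi_deriv by (intro continuous_at_imp_continuous_on ballI) (blast intro: DERIV_isCont)

text \<open>By the intermediate value theorem every point closer than \<open>rad w\<close> is a
  value of \<open>phi w\<close>; the two cases are the two orientations.\<close>

lemma rad_le_dist:
  assumes "z \<notin> phi w ` I"
  shows "rad w \<le> \<bar>z - phi w r\<bar>"
proof (rule ccontr)
  assume close: "\<not> rad w \<le> \<bar>z - phi w r\<bar>"
  have sub: "{q0..q1} \<subseteq> I"
    using q_order by auto
  then have cont: "continuous_on {q0..q1} (phi w)"
    using continuous_on_phi continuous_on_subset by blast
  have "inj_on (phi w) {q0..q1}"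
    using sub phi_inj by (meson inj_onI subsetD)
  with continuous_inj_imp_mono[of q0 r q1 "phi w"] cont q_order
  consider "phi w q0 < phi w r" "phi w r < phi w q1" | "phi w q1 < phi w r" "phi w r < phi w q0"
    by blast
  then have "\<exists>t. q0 \<le> t \<and> t \<le> q1 \<and> phi w t = z"
  proof cases
    case 1
    with close show ?thesis
      using q_order cont by (intro IVT') (auto simp: rad_def)
  next
    case 2
    with close show ?thesis
      using q_order cont by (intro IVT2') (auto simp: rad_def)
  qed
  with sub assms show False by auto
qed

lemma phi_separated: "v \<noteq> w \<Longrightarrow> min (rad v) (rad w) \<le> \<bar>phi v r - phi w r\<bar>"
  using phi_not_in_image[of v w] rad_le_dist[of "phi v r" w] rad_le_dist[of "phi w r" v]
  by (auto simp: abs_minus_commute)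

text \<open>Bounded distortion makes \<open>\<eta>\<close> uniform in \<open>w\<close>: ratios of
  distances in the image exceed those in the domain by at most \<open>exp D\<close>.\<close>

lemma phi_near_r:
  assumes "0 < \<delta>"
  shows "\<exists>\<eta>>0. \<forall>w t. \<bar>t - r\<bar> < \<eta> \<longrightarrow> \<bar>phi w t - phi w r\<bar> < \<delta> * rad w"
proof -
  define m where "m = min (r - q0) (q1 - r)"
  \<comment> \<open>The bound \<open>m\<close> keeps \<open>t\<close> between \<open>q0\<close> and
    \<open>q1\<close>; the other term absorbs the distortion factor.\<close>
  define \<eta> where "\<eta> = min m (\<delta> * m / exp D)"
  have m: "0 < m" using q_order by (simp add: m_def)
  have \<eta>: "0 < \<eta>" using m assms by (simp add: \<eta>_def)
  have "\<bar>phi w t - phi w r\<bar> < \<delta> * rad w" if t: "\<bar>t - r\<bar> < \<eta>" for w t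
  proof -
    have tq: "q0 < t" "t < q1"
      using t by (auto simp: \<eta>_def m_def abs_if split: if_splits)
    then have tI: "t \<in> I" using q_order by auto
    obtain \<xi> where \<xi>: "\<xi> \<in> {min r t..max r t}" "phi w t - phi w r = dphi w \<xi> * (t - r)"
      using phi_mvt[OF r_mem tI] by blast
    have \<xi>g: "\<xi> \<in> {g r<..<1}"
      using \<xi>(1) tq q_order by (auto simp: min_def max_def split: if_splits)
    have "\<bar>phi w t - phi w r\<bar> < \<delta> * \<bar>phi w q - phi w r\<bar>" if q: "q \<in> {g r<..<1}" "m \<le> \<bar>q - r\<bar>" for q
    proof -
      have qI: "q \<in> I" using q gr_mem by auto
      obtain \<zeta> where \<zeta>: "\<zeta> \<in> {min r q..max r q}" "phi w q - phi w r = dphi w \<zeta> * (q - r)"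
        using phi_mvt[OF r_mem qI] by blast
      have \<zeta>g: "\<zeta> \<in> {g r<..<1}" and \<zeta>I: "\<zeta> \<in> I"
        using \<zeta>(1) q q_order gr_mem r by (auto simp: min_def max_def split: if_splits)
      have dpos: "0 < \<bar>dphi w \<zeta>\<bar>"
        using dphi_nonzero[OF \<zeta>I] by simp
      have "\<bar>phi w t - phi w r\<bar> = \<bar>dphi w \<xi>\<bar> * \<bar>t - r\<bar>"
        by (simp add: \<xi>(2) abs_mult)
      also have "\<dots> \<le> exp D * \<bar>dphi w \<zeta>\<bar> * \<bar>t - r\<bar>"
        by (intro mult_right_mono bounded_distortion[OF \<xi>g \<zeta>g]) simp
      also have "\<dots> < exp D * \<bar>dphi w \<zeta>\<bar> * \<eta>"
        using t dpos by (intro mult_strict_left_mono) auto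
      also have "\<dots> \<le> exp D * \<bar>dphi w \<zeta>\<bar> * (\<delta> * m / exp D)"
        by (intro mult_left_mono) (auto simp: \<eta>_def)
      also have "\<dots> = \<delta> * (\<bar>dphi w \<zeta>\<bar> * m)"
        by simp
      also have "\<dots> \<le> \<delta> * (\<bar>dphi w \<zeta>\<bar> * \<bar>q - r\<bar>)"
        using q assms by (intro mult_left_mono) auto
      finally show ?thesis
        by (simp add: \<zeta>(2) abs_mult)
    qed
    from this[of q0] this[of q1] show ?thesis
      using q_order assms by (auto simp: rad_def m_def min_def abs_minus_commute)
  qed
  with \<eta> show ?thesis by blast
qed

text \<open>Each step of the orbit is undone by an inverse branch; an orbit that hit
  \<open>r\<close> would make \<open>x\<close> some \<open>phi w r\<close>.\<close>

lemma orbit_phi: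
  assumes "x \<in> I" "\<And>w. x \<noteq> phi w r"
  shows "(f ^^ n) x \<in> I \<and> (\<exists>w. x = phi w ((f ^^ n) x))"
proof (induction n)
  case 0
  show ?case
    using assms(1) by (auto intro: exI[of _ "[]"])
next
  case (Suc n)
  then obtain w where w: "x = phi w ((f ^^ n) x)" and z: "(f ^^ n) x \<in> I" by blast
  define z where "z = (f ^^ n) x"
  have "z \<noteq> r"
    using w assms(2) unfolding z_def by metis
  then have "f z \<in> I \<and> z = br (z < r) (f z)"
    using gf[of z] hf[of z] z by (auto simp: z_def br_def)
  moreover have "phi (w @ [z < r]) (f z) = phi w (br (z < r) (f z))"
    by (simp add: phi_append)
  ultimately show ?case
    using w by (metis comp_apply funpow.simps(2) z_def)
qed

text \<open>A point close to \<open>0\<close> whose predecessor lies on the right branch has its predecessor close to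
  \<open>r\<close> if that branch increases, and close to \<open>1\<close>, hence its second predecessor close to \<open>r\<close>, if it
  decreases.\<close>

lemma escape_bound:
  assumes mono: "strict_mono_on {r<..<1} f \<or> strict_antimono_on {r<..<1} f" and "0 < \<eta>"
  shows "\<exists>\<epsilon>>0. \<forall>s\<in>I. \<eta> \<le> \<bar>s - r\<bar> \<and> r < f s \<and> \<eta> \<le> \<bar>f s - r\<bar> \<longrightarrow> \<epsilon> \<le> f (f s)"
proof -
  \<comment> \<open>Halving makes \<open>\<theta>\<close> strictly smaller than
    \<open>\<eta>\<close> and keeps \<open>r - \<theta>\<close> and \<open>r + \<theta>\<close>
    inside \<open>I\<close>.\<close>
  define \<theta> where "\<theta> = min \<eta> (min r (1 - r)) / 2"
  have \<theta>: "0 < \<theta>" "\<theta> < \<eta>" "\<theta> < r" "\<theta> < 1 - r"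
    using assms r by (auto simp: \<theta>_def min_def)
  from mono show ?thesis
  proof
    assume m: "strict_mono_on {r<..<1} f"
    have "f (r + \<theta>) \<le> f (f s)" if "s \<in> I" "\<eta> \<le> \<bar>s - r\<bar>" "r < f s" "\<eta> \<le> \<bar>f s - r\<bar>" for s
    proof -
      have "f s \<in> I"
        using that gf(1)[of s] hf(1)[of s] assms(2) by (cases "s < r") auto
      with that \<theta> show ?thesis
        by (intro less_imp_le strict_mono_onD[OF m]) auto
    qed
    moreover have "0 < f (r + \<theta>)"
      using hf(1)[of "r + \<theta>"] \<theta> by auto
    ultimately show ?thesis by blast
  next
    assume m: "strict_antimono_on {r<..<1} f"
    have anti: "f y < f x" if "x \<in> {r<..<1}" "y \<in> {r<..<1}" "x < y" for x y
      using m that by (auto simp: monotone_on_def)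
    have left: "f x < f y" if "x \<in> {0<..<r}" "y \<in> {0<..<r}" "x < y" for x y
    proof (rule ccontr)
      assume "\<not> f x < f y"
      then have "g (f y) \<le> g (f x)"
        using gf(1)[OF that(1)] gf(1)[OF that(2)] by (intro g_mono) auto
      then show False
        using gf(2) that by auto
    qed
    \<comment> \<open>The first two terms bound \<open>f s\<close> away from 1 on either branch;
      \<open>(1 + r) / 2\<close> ensures \<open>r < k\<close>.\<close>
    define k where "k = max (max (f (r - \<theta>)) (f (r + \<theta>))) ((1 + r) / 2)"
    have k: "k \<in> {r<..<1}"
      using gf(1)[of "r - \<theta>"] hf(1)[of "r + \<theta>"] \<theta> r by (auto simp: k_def less_max_iff_disj)
    have "f k \<le> f (f s)" if s: "s \<in> I" "\<eta> \<le> \<bar>s - r\<bar>" "r < f s" "\<eta> \<le> \<bar>f s - r\<bar>" for s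
    proof -
      have "f s \<le> k"
      proof (cases "s < r")
        case True
        with s \<theta> have "f s < f (r - \<theta>)" by (intro left) auto
        then show ?thesis by (simp add: k_def)
      next
        case False
        with s \<theta> have "f s < f (r + \<theta>)" by (intro anti) auto
        then show ?thesis by (simp add: k_def)
      qed
      with k s anti[of "f s" k] show ?thesis
        by (cases "f s = k") auto
    qed
    moreover have "0 < f k"
      using hf(1)[OF k] by simp
    ultimately show ?thesis by blast
  qed
qed

text \<open>An orbit point within \<open>\<eta>\<close> of \<open>r\<close> would place
  \<open>x\<close> too close to some \<open>phi w r\<close>. Hence each right visit after the start
  is followed by a value at least \<open>\<epsilon>\<close>, and on the left branch \<open>f\<close>
  moves points up.\<close>

lemma orbit_bounded_below:
  assumes mono: "strict_mono_on {r<..<1} f \<or> strict_antimono_on {r<..<1} f"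
    and x: "x \<in> I" and "0 < \<delta>" and far: "\<And>w. \<delta> * rad w \<le> \<bar>x - phi w r\<bar>"
  shows "\<exists>\<epsilon>>0. \<forall>n. (f ^^ n) x \<in> I - {r} \<and> \<epsilon> \<le> (f ^^ n) x"
proof -
  obtain \<eta> where \<eta>: "0 < \<eta>" and near: "\<And>w t. \<bar>t - r\<bar> < \<eta> \<Longrightarrow> \<bar>phi w t - phi w r\<bar> < \<delta> * rad w"
    using phi_near_r[OF \<open>0 < \<delta>\<close>] by blast
  have ne: "x \<noteq> phi w r" for w
    using far[of w] mult_pos_pos[OF \<open>0 < \<delta>\<close> rad_pos[of w]] by auto
  define s where "s n = (f ^^ n) x" for n
  have s_Suc: "s (Suc n) = f (s n)" for n
    by (simp add: s_def)
  have sI: "s n \<in> I" for n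
    using orbit_phi[OF x ne] by (simp add: s_def)
  have s_far: "\<eta> \<le> \<bar>s n - r\<bar>" for n
  proof (rule ccontr)
    assume "\<not> \<eta> \<le> \<bar>s n - r\<bar>"
    moreover obtain w where "x = phi w (s n)"
      using orbit_phi[OF x ne] unfolding s_def by blast
    ultimately show False
      using near[of "s n" w] far[of w] by simp
  qed
  obtain \<epsilon> where \<epsilon>: "0 < \<epsilon>"
    "\<And>t. t \<in> I \<Longrightarrow> \<eta> \<le> \<bar>t - r\<bar> \<Longrightarrow> r < f t \<Longrightarrow> \<eta> \<le> \<bar>f t - r\<bar> \<Longrightarrow> \<epsilon> \<le> f (f t)"
    using escape_bound[OF mono \<eta>] by blast
  define \<epsilon>' where "\<epsilon>' = min \<epsilon> (min (s 0) (s 1))"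
  \<comment> \<open>Consecutive values are paired because the escape bound controls the point two
    steps later, so \<open>s 0\<close> and \<open>s 1\<close> both start the induction.\<close>
  have "\<epsilon>' \<le> s n \<and> \<epsilon>' \<le> s (Suc n)" for n
  proof (induction n)
    case 0
    show ?case unfolding \<epsilon>'_def by auto
  next
    case (Suc n)
    have "\<epsilon>' \<le> s (Suc (Suc n))"
    proof (cases "s (Suc n) < r")
      case True
      with f_gt[of "s (Suc n)"] sI[of "Suc n"] Suc show ?thesis
        by (simp add: s_Suc)
    next
      case False
      with s_far[of "Suc n"] \<eta> have "r < s (Suc n)" by auto
      with \<epsilon>(2)[OF sI s_far, of n] s_far[of "Suc n"] show ?thesis
        by (simp add: s_Suc \<epsilon>'_def)
    qed
    with Suc show ?case by blast
  qed
  moreover have "0 < \<epsilon>'"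
    using \<epsilon>(1) sI[of 0] sI[of 1] by (simp add: \<epsilon>'_def)
  moreover have "s n \<noteq> r" for n
    using s_far[of n] \<eta> by auto
  ultimately show ?thesis
    using sI unfolding s_def by blast
qed

lemma lower_lyapunov_pos:
  assumes "0 < \<epsilon>" and orbit: "\<And>n. (f ^^ n) x \<in> I - {r}" "\<And>n. \<epsilon> \<le> (f ^^ n) x"
  shows "0 < lower_lyapunov f f' x"
proof -
  \<comment> \<open>The term \<open>r / 2\<close> puts \<open>\<epsilon>'\<close> on the left
    branch, where monotonicity of \<open>f'\<close> gives a uniform expansion rate.\<close>
  define \<epsilon>' where "\<epsilon>' = min \<epsilon> (r / 2)"
  have \<epsilon>': "\<epsilon>' \<in> {0<..<r}"
    using \<open>0 < \<epsilon>\<close> r by (auto simp: \<epsilon>'_def)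
  define c where "c = min (f' \<epsilon>') \<kappa>"
  have c: "1 < c"
    using f'_left[OF \<epsilon>'] \<kappa> by (simp add: c_def)
  have expand: "c \<le> \<bar>f' ((f ^^ n) x)\<bar>" for n
  proof (cases "(f ^^ n) x < r")
    case True
    with orbit[of n] \<epsilon>' have "f' \<epsilon>' \<le> f' ((f ^^ n) x)"
      by (intro f'_mono) (auto simp: \<epsilon>'_def)
    then show ?thesis by (simp add: c_def)
  next
    case False
    with orbit[of n] f'_right[of "(f ^^ n) x"] show ?thesis
      by (auto simp: c_def)
  qed
  \<comment> \<open>For \<open>n = 0\<close> the right-hand side is 0 by the convention for
    division, hence the restriction.\<close>
  have "ln c \<le> 1 / real n * ln \<bar>\<Prod>k<n. f' ((f ^^ k) x)\<bar>" if "0 < n" for n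
  proof -
    have "(\<Prod>k<n. c) \<le> (\<Prod>k<n. \<bar>f' ((f ^^ k) x)\<bar>)"
      using expand c by (intro prod_mono) auto
    then have "c ^ n \<le> \<bar>\<Prod>k<n. f' ((f ^^ k) x)\<bar>"
      by (simp add: abs_prod)
    then have "ln (c ^ n) \<le> ln \<bar>\<Prod>k<n. f' ((f ^^ k) x)\<bar>"
      using c by (intro ln_mono) auto
    with c that show ?thesis
      by (simp add: ln_realpow field_simps)
  qed
  then have "eventually (\<lambda>n. ereal (ln c) \<le> ereal (1 / real n * ln \<bar>\<Prod>k<n. f' ((f ^^ k) x)\<bar>)) sequentially"
    by (intro eventually_sequentiallyI[of 1]) auto
  then have "ereal (ln c) \<le> lower_lyapunov f f' x"
    unfolding lower_lyapunov_def by (rule Liminf_bounded)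
  moreover have "0 < ereal (ln c)"
    using c by simp
  ultimately show ?thesis
    by (rule less_le_trans[rotated])
qed

theorem strong_winning_positive_exponent:
  assumes "strict_mono_on {r<..<1} f \<or> strict_antimono_on {r<..<1} f"
  shows "strong_winning {0..1} {x \<in> {0..1}. lower_lyapunov f f' x > 0}"
proof (rule strong_winning_avoid_separated_points)
  show "0 < rad w" "rad w \<le> 1" for w
    by (rule rad_pos rad_le_1)+
  show "min (rad v) (rad w) \<le> \<bar>phi v r - phi w r\<bar>" if "v \<noteq> w" for v w
    using that by (rule phi_separated)
  fix x \<delta>
  assume "x \<in> I" "0 < \<delta>" "\<And>w. \<delta> * rad w \<le> \<bar>x - phi w r\<bar>"
  then obtain \<epsilon> where "0 < \<epsilon>" "\<And>n. (f ^^ n) x \<in> I - {r}" "\<And>n. \<epsilon> \<le> (f ^^ n) x"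
    using orbit_bounded_below[OF assms] by metis
  then have "0 < lower_lyapunov f f' x"
    by (rule lower_lyapunov_pos)
  with \<open>x \<in> I\<close> show "x \<in> {x \<in> {0..1}. lower_lyapunov f f' x > 0}"
    by auto
qed

end

section \<open>Two-branched maps with a neutral fixed point\<close>

text \<open>What remains is to extract the uniform constants of the locale from the hypotheses and
  to construct the two inverse branches.\<close>

theorem corollary1p5:
  fixes f f' f'' :: "real \<Rightarrow> real" and r\<^sub>1 C \<gamma> :: real
  assumes "f \<in> {0..1} \<rightarrow> {0..1}"
    and "0 < r\<^sub>1" and "r\<^sub>1 < 1"
    and "f ` {0<..<r\<^sub>1} = {0<..<1}" and "f ` {r\<^sub>1<..<1} = {0<..<1}"
    and "branch_derivatives f r\<^sub>1 f' f''"
    and "f 0 = 0" and "f r\<^sub>1 = 0" and "f' 0 = 1"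
    and "\<forall>x\<in>{0<..1} - {r\<^sub>1}. \<bar>f' x\<bar> > 1"
    and "\<exists>l. (f' \<longlongrightarrow> l) (at_left r\<^sub>1) \<and> \<bar>l\<bar> > 1"
    and "\<exists>l. (f' \<longlongrightarrow> l) (at_right r\<^sub>1) \<and> \<bar>l\<bar> > 1"
    and "bdd_above ((\<lambda>x. \<bar>f' x\<bar>) ` {0..1})"
    and "bdd_above ((\<lambda>x. \<bar>f'' x\<bar>) ` {r\<^sub>1<..1})"
    and "C \<ge> 1" and "\<gamma> > 0"
    and "\<forall>x\<in>{0<..<r\<^sub>1}. 1 / C \<le> f'' x / x powr (\<gamma> - 1) \<and> f'' x / x powr (\<gamma> - 1) \<le> C"
  shows "strong_winning {0..1} {x \<in> {0..1}. lower_lyapunov f f' x > 0}"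
proof -
  define r where "r = r\<^sub>1"
  have r: "0 < r" "r < 1" using assms(2,3) by (simp_all add: r_def)
  note imgL = assms(4)[folded r_def] and imgR = assms(5)[folded r_def]
  note bd = assms(6)[unfolded branch_derivatives_def, folded r_def]
  have deriv: "(f has_real_derivative f' x) (at x)" if "x \<in> {0<..<1}" "x \<noteq> r" for x
  proof -
    have "(f has_real_derivative f' x) (at x within {0..1})"
      using bd that by auto
    then show ?thesis
      using that by (simp add: at_within_Icc_at)
  qed
  have deriv2: "(f' has_real_derivative f'' x) (at x)" if "x \<in> {0<..<1}" "x \<noteq> r" for x
  proof -
    have "(f' has_real_derivative f'' x) (at x within {0..1})"
      using bd that by auto
    then show ?thesis
      using that by (simp add: at_within_Icc_at)
  qed
  have f''_pos: "0 < f'' x" and f''_le: "f'' x \<le> C * x powr (\<gamma> - 1)" if "x \<in> {0<..<r}" for x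
  proof -
    have p: "0 < x powr (\<gamma> - 1)" using that by simp
    have *: "1 / C \<le> f'' x / x powr (\<gamma> - 1)" "f'' x / x powr (\<gamma> - 1) \<le> C"
      using assms(17) that by (auto simp: r_def)
    have "0 < f'' x / x powr (\<gamma> - 1)"
      using *(1) \<open>C \<ge> 1\<close> by (smt (verit) divide_pos_pos)
    with p show "0 < f'' x"
      by (simp add: zero_less_divide_iff)
    show "f'' x \<le> C * x powr (\<gamma> - 1)"
      using *(2) p by (simp add: pos_divide_le_eq)
  qed
  \<comment> \<open>Positivity of \<open>f''\<close> makes \<open>f'\<close> increase from
    \<open>f' 0 = 1\<close>, which settles the sign of \<open>f'\<close> as well as its
    size.\<close>
  have f'_left: "1 < f' x" if "x \<in> {0<..<r}" for x
  proof -
    have "f' 0 < f' x"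
    proof (rule DERIV_pos_imp_increasing_open[of 0 x f'])
      show "\<exists>y. (f' has_real_derivative y) (at z) \<and> 0 < y" if "0 < z" "z < x" for z
        using deriv2[of z] f''_pos[of z] that \<open>x \<in> {0<..<r}\<close> r by force
      have "continuous_on {0..<r} f'"
        using bd by blast
      then show "continuous_on {0..x} f'"
        by (rule continuous_on_subset) (use that in auto)
    qed (use that in auto)
    then show ?thesis using assms(9) by simp
  qed
  have "continuous_on {0..<r} f"
    unfolding continuous_on_eq_continuous_within
  proof
    fix x assume "x \<in> {0..<r}"
    then have "(f has_real_derivative f' x) (at x within {0..1})"
      using bd r by auto
    then show "continuous (at x within {0..<r}) f"
      by (rule continuous_within_subset[OF DERIV_continuous]) (use r in auto)
  qed
  then have contf: "continuous_on {0..x} f" if "x < r" for x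
    by (rule continuous_on_subset) (use that in auto)
  have f_gt: "x < f x" if x: "x \<in> {0<..<r}" for x
  proof -
    have "f 0 - 0 < f x - x"
    proof (rule DERIV_pos_imp_increasing_open[of 0 x "\<lambda>z. f z - z"])
      show "\<exists>y. ((\<lambda>z. f z - z) has_real_derivative y) (at z) \<and> 0 < y" if "0 < z" "z < x" for z
        using deriv[of z] f'_left[of z] that x r
        by (intro exI[of _ "f' z - 1"]) (auto intro!: derivative_eq_intros)
      show "continuous_on {0..x} (\<lambda>z. f z - z)"
        using contf x by (intro continuous_intros) auto
    qed (use x in auto)
    with assms(7) show ?thesis by simp
  qed
  obtain B where B: "\<And>x. x \<in> {0..1} \<Longrightarrow> \<bar>f' x\<bar> \<le> B"
    using assms(13) unfolding bdd_above_def by (metis imageI)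
  have f_le: "f x \<le> (B + 1) * x" if x: "x \<in> {0<..<r}" for x
  proof -
    \<comment> \<open>The slope \<open>B + 1\<close> instead of \<open>B\<close> makes the
      derivative strictly negative.\<close>
    have "f x - (B + 1) * x < f 0 - (B + 1) * 0"
    proof (rule DERIV_neg_imp_decreasing_open[of 0 x "\<lambda>z. f z - (B + 1) * z"])
      show "\<exists>y. ((\<lambda>z. f z - (B + 1) * z) has_real_derivative y) (at z) \<and> y < 0" if "0 < z" "z < x" for z
        using deriv[of z] B[of z] that x r
        by (intro exI[of _ "f' z - (B + 1)"]) (auto intro!: derivative_eq_intros)
      show "continuous_on {0..x} (\<lambda>z. f z - (B + 1) * z)"
        using contf x by (intro continuous_intros) auto
    qed (use x in auto)
    with assms(7) show ?thesis by simp
  qed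
  obtain M where M: "\<And>x. x \<in> {r<..1} \<Longrightarrow> \<bar>f'' x\<bar> \<le> M"
    using assms(14) unfolding bdd_above_def r_def by (metis imageI)
  have f'_lip: "\<bar>f' x - f' y\<bar> \<le> M * \<bar>x - y\<bar>" if xy: "x \<in> {r<..<1}" "y \<in> {r<..<1}" for x y
  proof -
    have "\<exists>\<xi>\<in>{min y x..max y x}. f' x - f' y = f'' \<xi> * (x - y)"
      by (rule mvt_between[of r 1]) (use deriv2 xy r in auto)
    then obtain \<xi> where \<xi>: "\<xi> \<in> {min y x..max y x}" "f' x - f' y = f'' \<xi> * (x - y)"
      by blast
    then have "\<bar>f'' \<xi>\<bar> \<le> M"
      using xy by (intro M) (auto simp: min_def max_def split: if_splits)
    then show ?thesis
      unfolding \<xi>(2) abs_mult by (rule mult_right_mono) simp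
  qed
  have contf': "continuous_on {r<..1} f'"
    unfolding continuous_on_eq_continuous_within
  proof
    fix x assume "x \<in> {r<..1}"
    then have "(f' has_real_derivative f'' x) (at x within {0..1})"
      using bd r by auto
    then show "continuous (at x within {r<..1}) f'"
      by (rule continuous_within_subset[OF DERIV_continuous]) (use r in auto)
  qed
  have abs_f'_gt: "1 < \<bar>f' x\<bar>" if "x \<in> {r<..1}" for x
    using assms(10) that r by (auto simp: r_def)
  \<comment> \<open>Near \<open>r\<close> the one-sided limit bounds the derivative away from 1; on
    the remaining compact interval a minimum is attained.\<close>
  have "\<exists>\<kappa>>1. \<forall>x\<in>{r<..<1}. \<kappa> \<le> \<bar>f' x\<bar>"
  proof -
    obtain l where l: "(f' \<longlongrightarrow> l) (at_right r)" "1 < \<bar>l\<bar>"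
      using assms(12) by (auto simp: r_def)
    define k where "k = (1 + \<bar>l\<bar>) / 2"
    have "((\<lambda>x. \<bar>f' x\<bar>) \<longlongrightarrow> \<bar>l\<bar>) (at_right r)"
      by (rule tendsto_rabs[OF l(1)])
    then have "eventually (\<lambda>x. k < \<bar>f' x\<bar>) (at_right r)"
      by (rule order_tendstoD(1)) (use l in \<open>simp add: k_def\<close>)
    then obtain b where b: "r < b" "\<And>x. r < x \<Longrightarrow> x < b \<Longrightarrow> k < \<bar>f' x\<bar>"
      by (auto simp: eventually_at_right_field)
    define d where "d = (r + min b 1) / 2"
    have d: "r < d" "d < b" "d < 1"
      using b(1) r by (auto simp: d_def min_def field_simps)
    have "continuous_on {d..1} (\<lambda>x. \<bar>f' x\<bar>)"
      by (intro continuous_on_rabs continuous_on_subset[OF contf']) (use d in auto)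
    then obtain z where z: "z \<in> {d..1}" "\<And>x. x \<in> {d..1} \<Longrightarrow> \<bar>f' z\<bar> \<le> \<bar>f' x\<bar>"
      using continuous_attains_inf[of "{d..1}" "\<lambda>x. \<bar>f' x\<bar>"] d by auto
    show ?thesis
    proof (intro exI[of _ "min k \<bar>f' z\<bar>"] conjI ballI)
      show "1 < min k \<bar>f' z\<bar>"
        using l z d abs_f'_gt[of z] by (simp add: k_def)
      show "min k \<bar>f' z\<bar> \<le> \<bar>f' x\<bar>" if "x \<in> {r<..<1}" for x
        using b(2)[of x] z(2)[of x] that d by (cases "x < d") auto
    qed
  qed
  then obtain \<kappa> where \<kappa>: "1 < \<kappa>" "\<And>x. x \<in> {r<..<1} \<Longrightarrow> \<kappa> \<le> \<bar>f' x\<bar>" by blast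
  have monoR: "strict_mono_on {r<..<1} f \<or> strict_antimono_on {r<..<1} f"
  proof (cases "\<forall>x\<in>{r<..<1}. 0 < f' x")
    case True
    have "f x < f y" if xy: "x \<in> {r<..<1}" "y \<in> {r<..<1}" "x < y" for x y
    proof (rule DERIV_pos_imp_increasing[OF xy(3)])
      fix z assume "x \<le> z" "z \<le> y"
      then show "\<exists>y. (f has_real_derivative y) (at z) \<and> 0 < y"
        using deriv[of z] True xy r by (intro exI[of _ "f' z"]) auto
    qed
    then show ?thesis by (intro disjI1 monotone_onI)
  next
    case False
    then obtain z where z: "z \<in> {r<..<1}" "f' z \<le> 0"
      by (auto simp: not_less)
    have conn: "connected (f' ` {r<..<1})"
      by (intro connected_continuous_image continuous_on_subset[OF contf']) auto
    \<comment> \<open>A change of sign would produce a zero of the continuous \<open>f'\<close>,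
      against \<open>abs_f'_gt\<close>.\<close>
    have neg: "f' x < 0" if x: "x \<in> {r<..<1}" for x
    proof (rule ccontr)
      assume "\<not> f' x < 0"
      then have "0 \<in> f' ` {r<..<1}"
        using connectedD_interval[OF conn, of "f' z" "f' x" 0] z x by auto
      then obtain y where "y \<in> {r<..<1}" "f' y = 0" by auto
      with abs_f'_gt[of y] show False by auto
    qed
    have "f y < f x" if xy: "x \<in> {r<..<1}" "y \<in> {r<..<1}" "x < y" for x y
    proof (rule DERIV_neg_imp_decreasing[OF xy(3)])
      fix z assume "x \<le> z" "z \<le> y"
      then show "\<exists>y. (f has_real_derivative y) (at z) \<and> y < 0"
        using deriv[of z] neg[of z] xy r by (intro exI[of _ "f' z"]) auto
    qed
    then show ?thesis by (intro disjI2 monotone_onI)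
  qed
  have monoL: "f x < f y" if xy: "x \<in> {0<..<r}" "y \<in> {0<..<r}" "x < y" for x y
  proof (rule DERIV_pos_imp_increasing[OF xy(3)])
    fix z assume "x \<le> z" "z \<le> y"
    then show "\<exists>y. (f has_real_derivative y) (at z) \<and> 0 < y"
      using deriv[of z] f'_left[of z] xy r by (intro exI[of _ "f' z"]) auto
  qed
  have injL: "inj_on f {0<..<r}"
    by (rule linorder_inj_onI) (use monoL in \<open>auto dest: less_imp_neq\<close>)
  have injR: "inj_on f {r<..<1}"
  proof (rule linorder_inj_onI)
    show "f x \<noteq> f y" if "x < y" "x \<in> {r<..<1}" "y \<in> {r<..<1}" for x y
      using monoR monotone_onD[of "{r<..<1}" "(<)" _ f x y] that by fastforce
  qed auto
  \<comment> \<open>The bound from \<open>f_le\<close> makes \<open>B + 1\<close> the constant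
    \<open>\<Lambda>\<close>.\<close>
  interpret parabolic_map f f' f'' "the_inv_into {0<..<r} f" "the_inv_into {r<..<1} f" r C \<gamma> M \<kappa> "B + 1"
  proof
    show "the_inv_into {0<..<r} f t \<in> {0<..<r}" if "t \<in> {0<..<1}" for t
      by (rule the_inv_into_into[OF injL]) (use that imgL in auto)
    show "f (the_inv_into {0<..<r} f t) = t" if "t \<in> {0<..<1}" for t
      by (rule f_the_inv_into_f[OF injL]) (use that imgL in auto)
    show "the_inv_into {r<..<1} f t \<in> {r<..<1}" if "t \<in> {0<..<1}" for t
      by (rule the_inv_into_into[OF injR]) (use that imgR in auto)
    show "f (the_inv_into {r<..<1} f t) = t" if "t \<in> {0<..<1}" for t
      by (rule f_the_inv_into_f[OF injR]) (use that imgR in auto)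
    show "f x \<in> {0<..<1}" if "x \<in> {0<..<r}" for x
      using imgL that by blast
    show "f x \<in> {0<..<1}" if "x \<in> {r<..<1}" for x
      using imgR that by blast
    show "(f' has_real_derivative f'' x) (at x)" if "x \<in> {0<..<r}" for x
      using deriv2[of x] that r by auto
  qed (use r \<open>\<gamma> > 0\<close> \<kappa> deriv f''_pos f''_le f'_left f'_lip f_gt f_le
      the_inv_into_f_f[OF injL] the_inv_into_f_f[OF injR] in auto)
  show ?thesis
    by (rule strong_winning_positive_exponent[OF monoR])
qed

end
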